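(* Let $\mathcal{M}=(\mathbb{R}^+\times\mathbb{R},\nabla)$, where $\nabla$ is a non-flat torsion-free connection with Christoffel symbols $\Gamma_{ij}{}^k=(x^1)^{-1}C_{ij}{}^k$, $C_{ij}{}^k=C_{ji}{}^k$ constant. Suppose that the space $\mathfrak{A}(\mathcal{M})$ is neither empty nor an affine line. Then, up to linear equivalence, one of the following alternatives holds: \begin{enumerate} \item $\mathcal{M}$ is also of Type $\mathcal{A}$, i.e. $C_{12}{}^1=0$, $C_{22}{}^1=0$, and $C_{22}{}^2=0$. \item $\mathcal{M}=\mathcal{P}_{-2,0}^\pm$ and $\mathfrak{A}(\mathcal{M})=\{-2\log(x^1)+c_1x^2+c_0:\ c_0,c_1\in\mathbb{R}\}$. \item $\mathcal{M}=\mathcal{P}_{-\frac12,c}^-$ with $c^2=\frac38$, and $\mathfrak{A}(\mathcal{M})=\{-\frac12\log(x^1)+c_1(x^2-2cx^1)+c_0:\ c_0,c_1\in\mathbb{R}\}$. \end{enumerate}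
   Context: $\nabla_{\partial_i}\partial_j=\Gamma_{ij}{}^k\partial_k$. $R(\xi_1,\xi_2)=\nabla_{\xi_1}\nabla_{\xi_2}-\nabla_{\xi_2}\nabla_{\xi_1}-\nabla_{[\xi_1,\xi_2]}$, $\rho(\xi_1,\xi_2)=\operatorname{Tr}\{\xi_3\mapsto R(\xi_3,\xi_1)\xi_2\}$, and $\rho^s$ is the symmetrization of $\rho$. $H_f^\nabla=\nabla(df)$ is the Hessian. $\mathfrak{A}(\mathcal{M})$ is the set of $f\in C^\infty(M)$ with $H_f^\nabla+\rho^s=0$; when non-empty it is an affine space modelled on $\ker(H^\nabla)=\{h:H_h^\nabla=0\}$, and "affine line" means a one-dimensional such affine space, i.e. $\mathfrak{A}(\mathcal{M})=f_0+\mathbb{R}$. Type $\mathcal{A}$ means locally homogeneous, non-flat, and admitting near each point local coordinates with constant Christoffel symbols. Two structures $C,\tilde C$ on $\mathbb{R}^+\times\mathbb{R}$ are linearly equivalent if $\tilde C=T^*C$ for some $T:(x^1,x^2)\mapsto(x^1,bx^1+cx^2)$, $c\ne0$. For $(a,c)\ne(0,0)$, $c\ge0$, the surfaces $\mathcal{P}_{a,c}^\pm$ are given on $\mathbb{R}^+\times\mathbb{R}$ by $\Gamma=(x^1)^{-1}C$ with $C_{11}{}^1=\frac12(a^2+4a\mp2c^2+2)$, $C_{11}{}^2=c$, $C_{12}{}^1=0$, $C_{12}{}^2=\frac12(a^2+2a\mp2c^2)$, $C_{22}{}^1=\pm1$, $C_{22}{}^2=\pm2c$. *)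

theory Defs
  imports "HOL-Analysis.Analysis"
begin

type_synonym plane = "real ^ 2"

definition frame :: "2 \<Rightarrow> plane \<Rightarrow> plane" where
  "frame i = (\<lambda>p. axis i 1)"

definition deriv_along :: "(plane \<Rightarrow> plane) \<Rightarrow> (plane \<Rightarrow> 'b::real_normed_vector) \<Rightarrow> plane \<Rightarrow> 'b" where
  "deriv_along X f = (\<lambda>p. frechet_derivative f (at p) (X p))"

text \<open>Class \<open>C\<^sup>k\<close>; only used on open sets.\<close>

primrec Ck_on :: "nat \<Rightarrow> plane set \<Rightarrow> (plane \<Rightarrow> 'b::real_normed_vector) \<Rightarrow> bool" where
  "Ck_on 0 S f \<longleftrightarrow> continuous_on S f"
| "Ck_on (Suc k) S f \<longleftrightarrow>
     f differentiable_on S \<and> (\<forall>i. Ck_on k S (deriv_along (frame i) f))"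

definition smooth_on :: "plane set \<Rightarrow> (plane \<Rightarrow> 'b::real_normed_vector) \<Rightarrow> bool" where
  "smooth_on S f \<longleftrightarrow> (\<forall>k. Ck_on k S f)"

definition diffeo :: "plane set \<Rightarrow> plane set \<Rightarrow> (plane \<Rightarrow> plane) \<Rightarrow> bool" where
  "diffeo U V \<phi> \<longleftrightarrow> open U \<and> open V \<and> smooth_on U \<phi> \<and> \<phi> ` U = V \<and>
     (\<exists>\<psi>. smooth_on V \<psi> \<and> \<psi> ` V = U \<and> (\<forall>p\<in>U. \<psi> (\<phi> p) = p) \<and> (\<forall>q\<in>V. \<phi> (\<psi> q) = q))"

text \<open>\<open>C i j k\<close> stands for \<open>C\<^sub>i\<^sub>j\<^sup>k\<close>; a connection is given by its Christoffel symbols at each point.\<close>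

type_synonym christoffel = "2 \<Rightarrow> 2 \<Rightarrow> 2 \<Rightarrow> real"
type_synonym connection = "plane \<Rightarrow> christoffel"

definition nabla :: "connection \<Rightarrow> (plane \<Rightarrow> plane) \<Rightarrow> (plane \<Rightarrow> plane) \<Rightarrow> plane \<Rightarrow> plane" where
  "nabla \<Gamma> X Y = (\<lambda>p. deriv_along X Y p
     + (\<chi> k. \<Sum>i\<in>UNIV. \<Sum>j\<in>UNIV. \<Gamma> p i j k * X p $ i * Y p $ j))"

definition lie_bracket :: "(plane \<Rightarrow> plane) \<Rightarrow> (plane \<Rightarrow> plane) \<Rightarrow> plane \<Rightarrow> plane" where
  "lie_bracket X Y = (\<lambda>p. deriv_along X Y p - deriv_along Y X p)"

definition curvature ::
  "connection \<Rightarrow> (plane \<Rightarrow> plane) \<Rightarrow> (plane \<Rightarrow> plane) \<Rightarrow> (plane \<Rightarrow> plane) \<Rightarrow> plane \<Rightarrow> plane" where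
  "curvature \<Gamma> X Y Z = (\<lambda>p. nabla \<Gamma> X (nabla \<Gamma> Y Z) p - nabla \<Gamma> Y (nabla \<Gamma> X Z) p
     - nabla \<Gamma> (lie_bracket X Y) Z p)"

definition ricci :: "connection \<Rightarrow> (plane \<Rightarrow> plane) \<Rightarrow> (plane \<Rightarrow> plane) \<Rightarrow> plane \<Rightarrow> real" where
  "ricci \<Gamma> X Y = (\<lambda>p. \<Sum>k\<in>UNIV. curvature \<Gamma> (frame k) X Y p $ k)"

definition ricci_sym :: "connection \<Rightarrow> (plane \<Rightarrow> plane) \<Rightarrow> (plane \<Rightarrow> plane) \<Rightarrow> plane \<Rightarrow> real" where
  "ricci_sym \<Gamma> X Y = (\<lambda>p. (ricci \<Gamma> X Y p + ricci \<Gamma> Y X p) / 2)"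

text \<open>\<open>(\<nabla>df)(X, Y) = X(Y f) - (\<nabla>\<^sub>X Y) f\<close>\<close>

definition hessian ::
  "connection \<Rightarrow> (plane \<Rightarrow> real) \<Rightarrow> (plane \<Rightarrow> plane) \<Rightarrow> (plane \<Rightarrow> plane) \<Rightarrow> plane \<Rightarrow> real" where
  "hessian \<Gamma> f X Y = (\<lambda>p. deriv_along X (deriv_along Y f) p - deriv_along (nabla \<Gamma> X Y) f p)"

text \<open>Curvature, Ricci tensor and Hessian are tensorial, so they are tested on the coordinate frame.\<close>

definition flat_on :: "plane set \<Rightarrow> connection \<Rightarrow> bool" where
  "flat_on M \<Gamma> \<longleftrightarrow> (\<forall>p\<in>M. \<forall>i j k. curvature \<Gamma> (frame i) (frame j) (frame k) p = 0)"

text \<open>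
  The space \<open>\<AA>(M, \<nabla>)\<close>. Functions on \<open>M\<close> are represented by functions on the whole plane that
  take the value \<open>undefined\<close> outside \<open>M\<close>, so that equality is equality on \<open>M\<close>.
\<close>

definition soliton_potentials :: "plane set \<Rightarrow> connection \<Rightarrow> (plane \<Rightarrow> real) set" where
  "soliton_potentials M \<Gamma> = {f \<in> extensional M. smooth_on M f \<and>
     (\<forall>p\<in>M. \<forall>i j. hessian \<Gamma> f (frame i) (frame j) p + ricci_sym \<Gamma> (frame i) (frame j) p = 0)}"

definition is_affine_line :: "plane set \<Rightarrow> (plane \<Rightarrow> real) set \<Rightarrow> bool" where
  "is_affine_line M A \<longleftrightarrow> (\<exists>f0. A = {(\<lambda>p\<in>M. f0 p + t) | t. True})"

text \<open>
  \<open>\<Gamma> = \<phi>\<^sup>*\<Gamma>'\<close> on \<open>U\<close>, i.e. \<open>d\<phi>(\<nabla>\<^sub>\<partial>\<^sub>i \<partial>\<^sub>j) = \<nabla>'\<^sub>\<partial>\<^sub>i (d\<phi> \<partial>\<^sub>j)\<close>, where on the right \<open>\<nabla>'\<close> acts on vector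
  fields along \<open>\<phi>\<close>.
\<close>

definition is_pullback :: "plane set \<Rightarrow> (plane \<Rightarrow> plane) \<Rightarrow> connection \<Rightarrow> connection \<Rightarrow> bool" where
  "is_pullback U \<phi> \<Gamma>' \<Gamma> \<longleftrightarrow> (\<forall>p\<in>U. \<forall>i j.
     (\<Sum>k\<in>UNIV. \<Gamma> p i j k *\<^sub>R deriv_along (frame k) \<phi> p) =
     deriv_along (frame i) (deriv_along (frame j) \<phi>) p
     + (\<chi> m. \<Sum>a\<in>UNIV. \<Sum>b\<in>UNIV. \<Gamma>' (\<phi> p) a b m
          * deriv_along (frame i) \<phi> p $ a * deriv_along (frame j) \<phi> p $ b))"

definition locally_homogeneous :: "plane set \<Rightarrow> connection \<Rightarrow> bool" where
  "locally_homogeneous M \<Gamma> \<longleftrightarrow> (\<forall>p\<in>M. \<forall>q\<in>M. \<exists>U V \<phi>.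
     p \<in> U \<and> U \<subseteq> M \<and> V \<subseteq> M \<and> diffeo U V \<phi> \<and> \<phi> p = q \<and> is_pullback U \<phi> \<Gamma> \<Gamma>)"

definition type_A :: "plane set \<Rightarrow> connection \<Rightarrow> bool" where
  "type_A M \<Gamma> \<longleftrightarrow> locally_homogeneous M \<Gamma> \<and> \<not> flat_on M \<Gamma> \<and>
     (\<forall>p\<in>M. \<exists>U V \<phi> (C::christoffel).
        p \<in> U \<and> U \<subseteq> M \<and> diffeo U V \<phi> \<and> is_pullback U \<phi> (\<lambda>_. C) \<Gamma>)"

definition half_plane :: "plane set" where
  "half_plane = {p. p $ 1 > 0}"

definition type_B_conn :: "christoffel \<Rightarrow> connection" where
  "type_B_conn C = (\<lambda>p i j k. C i j k / p $ 1)"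

definition shear :: "real \<Rightarrow> real \<Rightarrow> plane \<Rightarrow> plane" where
  "shear b c = (\<lambda>p. vector [p $ 1, b * p $ 1 + c * p $ 2])"

definition linearly_equivalent :: "christoffel \<Rightarrow> christoffel \<Rightarrow> bool" where
  "linearly_equivalent C C' \<longleftrightarrow>
     (\<exists>b c. c \<noteq> 0 \<and> is_pullback half_plane (shear b c) (type_B_conn C) (type_B_conn C'))"

text \<open>
  The coefficients of \<open>\<P>\<^sub>a\<^sub>,\<^sub>c\<^sup>\<plusminus>\<close>, with \<open>s = 1\<close> for the upper and \<open>s = -1\<close> for the lower sign.
  Only used for \<open>s \<in> {1, -1}\<close>, \<open>(a, c) \<noteq> (0, 0)\<close> and \<open>c \<ge> 0\<close>.
\<close>

definition P_surface :: "real \<Rightarrow> real \<Rightarrow> real \<Rightarrow> christoffel" where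
  "P_surface s a c = (\<lambda>i j k.
     if i = 1 \<and> j = 1 then (if k = 1 then (a\<^sup>2 + 4 * a - 2 * s * c\<^sup>2 + 2) / 2 else c)
     else if i = 2 \<and> j = 2 then (if k = 1 then s else 2 * s * c)
     else (if k = 1 then 0 else (a\<^sup>2 + 2 * a - 2 * s * c\<^sup>2) / 2))"

end

theory Submission
  imports Defs
begin

text \<open>
  Two potentials that do not differ by a constant give a nonconstant \<open>h\<close> with vanishing Hessian.
  Integrability of the system for \<open>dh\<close> gives \<open>K dh = 0\<close> for the curvature matrix \<open>K\<close>, and then
  also \<open>K \<partial>\<^sub>i dh = 0\<close>. Since \<open>K \<noteq> 0\<close>, \<open>dh\<close> spans the kernel of \<open>K\<close> and is a common
  eigenvector of \<open>C\<^sub>1\<close> and \<open>C\<^sub>2\<close>, annihilated by \<open>C\<^sub>2\<close>. If \<open>dh\<close> is proportional to \<open>dx\<^sup>1\<close>, the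
  integrability conditions for a potential \<open>f\<close> force \<open>C\<^sub>2\<^sub>2\<^sup>2 = 0\<close>, which is Type A. Otherwise
  \<open>h\<close> is a multiple of \<open>x\<^sup>2 + k x\<^sup>1\<close> up to a constant, and those conditions leave one free scale
  in each of two cases, which a shear normalises to the two exceptional surfaces.
\<close>

subsection \<open>Derivatives and smoothness in the plane\<close>

text \<open>Neither \<open>f\<close> nor \<open>h\<close> is solved for on a general surface.
  Because the \<open>C i j k\<close> are constants, scaling the gradient by x^1 turns each
  integrability condition into an algebraic relation with constant coefficients, and the
  classification uses these relations at a single point where dh does not vanish. The obstacle is
  that such a relation sees the gradient only through K: it has to be differentiated to bring in the
  connection itself, and for \<open>f\<close> the inhomogeneous terms must be eliminated before the
  nonzero K can be cancelled. What survives is a single unknown number, which ends up as the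
  coefficient of log x^1. Solution spaces are never transported along shears: only the coefficients
  are normalised, and the potentials are computed directly on the two model surfaces. The Type A
  alternative needs no shear at all.\<close>

lemma deriv_along_frame_eqI:
  assumes "(f has_derivative f') (at p)"
  shows "deriv_along (frame i) f p = f' (axis i 1)"
  using frechet_derivative_at[OF assms] by (simp add: deriv_along_def frame_def)

lemma deriv_along_frame_cong:
  assumes "open S" "p \<in> S" "f differentiable at p" "\<And>q. q \<in> S \<Longrightarrow> f q = g q"
  shows "deriv_along (frame i) g p = deriv_along (frame i) f p"
  using frechet_derivative_transform_within_open[OF assms(3,1,2,4)] by (simp add: deriv_along_def)

lemma deriv_along_diff:
  assumes "f differentiable at p" "g differentiable at p"
  shows "deriv_along X (\<lambda>p. f p - g p) p = deriv_along X f p - deriv_along X g p"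
  using frechet_derivative_at[OF has_derivative_diff[OF assms[unfolded frechet_derivative_works]], symmetric]
  by (simp add: deriv_along_def)

lemma has_derivative_deriv_along:
  fixes f :: "plane \<Rightarrow> 'b::real_normed_vector"
  assumes "f differentiable at p"
  shows "(f has_derivative (\<lambda>v. \<Sum>i\<in>UNIV. v $ i *\<^sub>R deriv_along (frame i) f p)) (at p)"
proof -
  let ?F = "frechet_derivative f (at p)"
  have F: "(f has_derivative ?F) (at p)"
    using assms by (simp add: frechet_derivative_works)
  have lin: "linear ?F" using assms by (rule linear_frechet_derivative)
  have "?F v = (\<Sum>i\<in>UNIV. v $ i *\<^sub>R deriv_along (frame i) f p)" for v
  proof -
    have "?F v = ?F (\<Sum>i\<in>UNIV. v $ i *\<^sub>R axis i 1)"
      by (simp only: basis_expansion flip: scalar_mult_eq_scaleR)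
    then show ?thesis
      by (simp add: linear_sum[OF lin] linear_cmul[OF lin] deriv_along_def frame_def)
  qed
  then have "?F = (\<lambda>v. \<Sum>i\<in>UNIV. v $ i *\<^sub>R deriv_along (frame i) f p)" by blast
  with F show ?thesis by simp
qed

section \<open>Calculus of smooth functions on open sets\<close>

lemma smooth_on_unfold:
  "open S \<Longrightarrow> smooth_on S f \<longleftrightarrow> f differentiable_on S \<and> (\<forall>i. smooth_on S (deriv_along (frame i) f))"
  unfolding smooth_on_def
  by (metis Ck_on.simps differentiable_imp_continuous_on not0_implies_Suc)

lemma smooth_on_differentiable:
  "open S \<Longrightarrow> smooth_on S f \<Longrightarrow> p \<in> S \<Longrightarrow> f differentiable at p"
  by (metis smooth_on_unfold at_within_open differentiable_on_def)

lemma smooth_on_deriv_along: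
  "open S \<Longrightarrow> smooth_on S f \<Longrightarrow> smooth_on S (deriv_along (frame i) f)"
  by (metis smooth_on_unfold)

lemma smooth_on_imp_continuous_on: "smooth_on S f \<Longrightarrow> continuous_on S f"
  unfolding smooth_on_def by (metis Ck_on.simps(1))

text \<open>On an open set derivatives depend only on the values there. This is what makes functions
  usable that are \<open>undefined\<close> off the half plane.\<close>

lemma Ck_on_cong:
  assumes "open S"
  shows "Ck_on k S f \<Longrightarrow> (\<And>q. q \<in> S \<Longrightarrow> f q = g q) \<Longrightarrow> Ck_on k S g"
proof (induction k arbitrary: f g)
  case 0
  then show ?case by (metis Ck_on.simps(1) continuous_on_cong)
next
  case (Suc k)
  have df: "f differentiable_on S" using Suc.prems(1) by simp
  have g: "g differentiable_on S"
    using df Suc.prems(2) by (metis differentiable_on_def differentiable_transform_within zero_less_one)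
  have "Ck_on k S (deriv_along (frame i) g)" for i
  proof (rule Suc.IH)
    show "Ck_on k S (deriv_along (frame i) f)" using Suc.prems(1) by simp
    fix q assume q: "q \<in> S"
    have "f differentiable at q"
      using df q assms by (simp add: differentiable_on_eq_differentiable_at)
    then show "deriv_along (frame i) f q = deriv_along (frame i) g q"
      using deriv_along_frame_cong[OF assms q _ Suc.prems(2)] by simp
  qed
  with g show ?case by simp
qed

lemma smooth_on_cong:
  assumes "open S" "smooth_on S f" "\<And>q. q \<in> S \<Longrightarrow> f q = g q"
  shows "smooth_on S g"
  using assms Ck_on_cong unfolding smooth_on_def by blast

text \<open>Induction on the order needs only a class \<open>X\<close> that is closed under partial
  derivatives, up to equality on \<open>S\<close>. For explicit functions such a class is easily
  written down, so no product or chain rule for \<open>smooth_on\<close> is required.\<close>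

lemma smooth_on_coinduct:
  assumes "open S" "X f"
    and step: "\<And>g. X g \<Longrightarrow> \<exists>g'. (\<forall>p\<in>S. (g has_derivative g' p) (at p)) \<and>
           (\<forall>i. \<exists>h. X h \<and> (\<forall>p\<in>S. g' p (axis i 1) = h p))"
  shows "smooth_on S f"
proof -
  have "Ck_on k S g" if "X g" for k g
    using that
  proof (induction k arbitrary: g)
    case 0
    from step[OF 0] show ?case
      by (auto simp: continuous_on_eq_continuous_within intro: has_derivative_continuous has_derivative_at_withinI)
  next
    case (Suc k)
    from step[OF Suc.prems] obtain g' where g': "\<And>p. p \<in> S \<Longrightarrow> (g has_derivative g' p) (at p)"
      and h: "\<forall>i. \<exists>h. X h \<and> (\<forall>p\<in>S. g' p (axis i 1) = h p)" by blast
    have "g differentiable_on S"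
      using g' by (meson differentiable_def differentiable_at_imp_differentiable_on)
    moreover have "Ck_on k S (deriv_along (frame i) g)" for i
    proof -
      obtain h where "X h" and hp: "\<And>p. p \<in> S \<Longrightarrow> g' p (axis i 1) = h p" using h by blast
      show ?thesis
        by (rule Ck_on_cong[OF \<open>open S\<close> Suc.IH[OF \<open>X h\<close>]])
          (use g' hp deriv_along_frame_eqI in metis)
    qed
    ultimately show ?case by simp
  qed
  with \<open>X f\<close> show ?thesis by (simp add: smooth_on_def)
qed

lemma smooth_on_const: "open S \<Longrightarrow> smooth_on S (\<lambda>p. c)"
  by (rule smooth_on_coinduct[where X = "\<lambda>f. \<exists>c. f = (\<lambda>p. c)"])
    (auto intro!: exI[of _ "\<lambda>p v. 0"])

lemma Ck_on_add:
  fixes f g :: "plane \<Rightarrow> 'b::real_normed_vector"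
  assumes "open S"
  shows "Ck_on k S f \<Longrightarrow> Ck_on k S g \<Longrightarrow> Ck_on k S (\<lambda>p. f p + g p)"
proof (induction k arbitrary: f g)
  case 0
  then show ?case by (simp add: continuous_on_add)
next
  case (Suc k)
  have d: "f differentiable at q" "g differentiable at q" if "q \<in> S" for q
    using that Suc.prems assms differentiable_on_eq_differentiable_at by (metis Ck_on.simps(2))+
  have e: "((\<lambda>p. f p + g p) has_derivative
      (\<lambda>v. frechet_derivative f (at q) v + frechet_derivative g (at q) v)) (at q)" if "q \<in> S" for q
    using d[OF that] unfolding frechet_derivative_works by (rule has_derivative_add)
  have "Ck_on k S (deriv_along (frame i) (\<lambda>p. f p + g p))" for i
  proof (rule Ck_on_cong[OF assms])
    show "Ck_on k S (\<lambda>p. deriv_along (frame i) f p + deriv_along (frame i) g p)"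
      using Suc.IH Suc.prems by simp
    fix q assume "q \<in> S"
    show "deriv_along (frame i) f q + deriv_along (frame i) g q = deriv_along (frame i) (\<lambda>p. f p + g p) q"
      using frechet_derivative_at[OF e[OF \<open>q \<in> S\<close>], symmetric] by (simp add: deriv_along_def)
  qed
  with Suc.prems show ?case by simp
qed

lemma smooth_on_add:
  "open S \<Longrightarrow> smooth_on S f \<Longrightarrow> smooth_on S g \<Longrightarrow> smooth_on S (\<lambda>p. f p + g p)"
  unfolding smooth_on_def using Ck_on_add by blast

lemma Ck_on_bounded_linear:
  assumes L: "bounded_linear L" and "open S"
  shows "Ck_on k S f \<Longrightarrow> Ck_on k S (\<lambda>p. L (f p))"
proof (induction k arbitrary: f)
  case 0
  then show ?case by (simp add: bounded_linear.continuous_on[OF L])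
next
  case (Suc k)
  have d: "f differentiable at q" if "q \<in> S" for q
    using that Suc.prems assms differentiable_on_eq_differentiable_at by (metis Ck_on.simps(2))+
  have e: "((\<lambda>p. L (f p)) has_derivative (\<lambda>v. L (frechet_derivative f (at q) v))) (at q)" if "q \<in> S" for q
    using bounded_linear.has_derivative[OF L] d[OF that] frechet_derivative_works by blast
  have "Ck_on k S (deriv_along (frame i) (\<lambda>p. L (f p)))" for i
  proof (rule Ck_on_cong[OF \<open>open S\<close>])
    show "Ck_on k S (\<lambda>p. L (deriv_along (frame i) f p))"
      using Suc.IH Suc.prems by simp
    fix q assume "q \<in> S"
    show "L (deriv_along (frame i) f q) = deriv_along (frame i) (\<lambda>p. L (f p)) q"
      using frechet_derivative_at[OF e[OF \<open>q \<in> S\<close>], symmetric]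
      by (simp add: deriv_along_def)
  qed
  moreover have "(\<lambda>p. L (f p)) differentiable_on S"
    using e by (meson differentiable_def differentiable_at_imp_differentiable_on)
  ultimately show ?case by simp
qed

lemma smooth_on_bounded_linear:
  "bounded_linear L \<Longrightarrow> open S \<Longrightarrow> smooth_on S f \<Longrightarrow> smooth_on S (\<lambda>p. L (f p))"
  unfolding smooth_on_def using Ck_on_bounded_linear by blast

section \<open>Symmetry of second derivatives\<close>

text \<open>The mean value theorem is applied once in direction \<open>i\<close> to the difference
  in direction \<open>j\<close>, then once in direction \<open>j\<close> to the derivative so
  obtained.\<close>

lemma mixed_difference:
  fixes f :: "plane \<Rightarrow> real"
  assumes "0 < h" and box: "\<And>s t. 0 \<le> s \<Longrightarrow> s \<le> h \<Longrightarrow> 0 \<le> t \<Longrightarrow> t \<le> h \<Longrightarrow>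
      p + s *\<^sub>R axis i 1 + t *\<^sub>R axis j 1 \<in> S"
    and f: "\<And>q. q \<in> S \<Longrightarrow> f differentiable at q"
    and df: "\<And>q. q \<in> S \<Longrightarrow> deriv_along (frame i) f differentiable at q"
  obtains s t where "0 < s" "s < h" "0 < t" "t < h"
    "f (p + h *\<^sub>R axis i 1 + h *\<^sub>R axis j 1) - f (p + h *\<^sub>R axis i 1) - f (p + h *\<^sub>R axis j 1) + f p
       = h\<^sup>2 * deriv_along (frame j) (deriv_along (frame i) f) (p + s *\<^sub>R axis i 1 + t *\<^sub>R axis j 1)"
proof -
  let ?ei = "axis i 1 :: plane" and ?ej = "axis j 1 :: plane"
  let ?g = "deriv_along (frame i) f"
  have line: "((\<lambda>s. F (q + s *\<^sub>R axis k 1)) has_real_derivative deriv_along (frame k) F (q + s *\<^sub>R axis k 1)) (at s)"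
    if "F differentiable at (q + s *\<^sub>R axis k 1)" for F :: "plane \<Rightarrow> real" and q s k
  proof -
    let ?F = "frechet_derivative F (at (q + s *\<^sub>R axis k 1))"
    have "((\<lambda>s. F (q + s *\<^sub>R axis k 1)) has_derivative (\<lambda>v. ?F (v *\<^sub>R axis k 1))) (at s)"
      by (rule has_derivative_compose[where f = "\<lambda>s. q + s *\<^sub>R axis k 1"])
        (use that in \<open>auto intro!: derivative_eq_intros simp: frechet_derivative_works\<close>)
    moreover have "(\<lambda>v. ?F (v *\<^sub>R axis k 1)) = (*) (?F (axis k 1))"
      by (simp add: linear_cmul[OF linear_frechet_derivative[OF that]] fun_eq_iff)
    ultimately show ?thesis
      by (simp add: has_field_derivative_def deriv_along_def frame_def)
  qed
  have *: "((\<lambda>s. f (p + s *\<^sub>R ?ei + h *\<^sub>R ?ej) - f (p + s *\<^sub>R ?ei)) has_real_derivative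
      ?g (p + s *\<^sub>R ?ei + h *\<^sub>R ?ej) - ?g (p + s *\<^sub>R ?ei)) (at s)" if "0 \<le> s" "s \<le> h" for s
  proof (rule DERIV_diff)
    show "((\<lambda>s. f (p + s *\<^sub>R ?ei + h *\<^sub>R ?ej)) has_real_derivative ?g (p + s *\<^sub>R ?ei + h *\<^sub>R ?ej)) (at s)"
      using line[of f "p + h *\<^sub>R ?ej" s i] f[OF box[OF that, of h]] \<open>0 < h\<close> by (simp add: algebra_simps)
    show "((\<lambda>s. f (p + s *\<^sub>R ?ei)) has_real_derivative ?g (p + s *\<^sub>R ?ei)) (at s)"
      using line[of f p s i] f[OF box[OF that, of 0]] \<open>0 < h\<close> by simp
  qed
  obtain s where s: "0 < s" "s < h" and 1: "(f (p + h *\<^sub>R ?ei + h *\<^sub>R ?ej) - f (p + h *\<^sub>R ?ei)) -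
      (f (p + 0 *\<^sub>R ?ei + h *\<^sub>R ?ej) - f (p + 0 *\<^sub>R ?ei))
      = (h - 0) * (?g (p + s *\<^sub>R ?ei + h *\<^sub>R ?ej) - ?g (p + s *\<^sub>R ?ei))"
    using MVT2[OF \<open>0 < h\<close> *] by blast
  have "((\<lambda>t. ?g (p + s *\<^sub>R ?ei + t *\<^sub>R ?ej)) has_real_derivative
      deriv_along (frame j) ?g (p + s *\<^sub>R ?ei + t *\<^sub>R ?ej)) (at t)" if "0 \<le> t" "t \<le> h" for t
    using line[of ?g "p + s *\<^sub>R ?ei" t j] df[OF box, of s t] that s by simp
  from MVT2[OF \<open>0 < h\<close> this] obtain t where t: "0 < t" "t < h"
    and 2: "?g (p + s *\<^sub>R ?ei + h *\<^sub>R ?ej) - ?g (p + s *\<^sub>R ?ei + 0 *\<^sub>R ?ej)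
      = (h - 0) * deriv_along (frame j) ?g (p + s *\<^sub>R ?ei + t *\<^sub>R ?ej)" by blast
  show thesis
    by (rule that[OF s t]) (use 1 2 in \<open>simp add: power2_eq_square\<close>)
qed

text \<open>The second difference over a square is symmetric in the two directions, so it is h^2
  times either mixed derivative, each taken at some point of the square. Were the two different at
  \<open>p\<close>, continuity would keep them apart on a small square.\<close>

lemma deriv_along_commute:
  fixes f :: "plane \<Rightarrow> real"
  assumes "open S" "smooth_on S f" "p \<in> S"
  shows "deriv_along (frame i) (deriv_along (frame j) f) p = deriv_along (frame j) (deriv_along (frame i) f) p"
proof (rule ccontr)
  let ?D = "\<lambda>i j. deriv_along (frame i) (deriv_along (frame j) f)"
  assume "?D i j p \<noteq> ?D j i p"
  then have e: "0 < dist (?D i j p) (?D j i p) / 2" (is "0 < ?e") by simp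
  have sm: "smooth_on S (deriv_along (frame k) f)" for k
    using assms by (intro smooth_on_deriv_along)
  have cont: "continuous (at p) (?D k l)" for k l
    using assms smooth_on_imp_continuous_on[OF smooth_on_deriv_along[OF \<open>open S\<close> sm]]
    by (simp add: continuous_on_eq_continuous_at)
  obtain d1 where d1: "d1 > 0" "\<And>q. dist q p < d1 \<Longrightarrow> dist (?D i j q) (?D i j p) < ?e"
    using cont[of i j] e unfolding continuous_at_eps_delta dist_norm by blast
  obtain d2 where d2: "d2 > 0" "\<And>q. dist q p < d2 \<Longrightarrow> dist (?D j i q) (?D j i p) < ?e"
    using cont[of j i] e unfolding continuous_at_eps_delta dist_norm by blast
  obtain d3 where d3: "d3 > 0" "ball p d3 \<subseteq> S" using assms openE by blast
  define d where "d = Min {d1, d2, d3}"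
  have d: "d > 0" "d \<le> d1" "d \<le> d2" "d \<le> d3" using d1 d2 d3 by (auto simp: d_def)
  \<comment> \<open>With side d/3 every point of the square is at distance at most 2d/3 from
    \<open>p\<close>.\<close>
  define h where "h = d / 3"
  have h: "h > 0" using d by (simp add: h_def)
  have near: "dist (p + s *\<^sub>R axis k 1 + t *\<^sub>R axis l 1) p < d"
    if "0 \<le> s" "s \<le> h" "0 \<le> t" "t \<le> h" for s t k l
  proof -
    have "norm (s *\<^sub>R axis k 1 + t *\<^sub>R axis l 1 :: plane) \<le> s + t"
      by (rule order_trans[OF norm_triangle_ineq]) (use that in simp)
    also have "\<dots> < d" using that d by (simp add: h_def)
    finally show ?thesis by (simp add: dist_norm)
  qed
  have inS: "p + s *\<^sub>R axis k 1 + t *\<^sub>R axis l 1 \<in> S"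
    if "0 \<le> s" "s \<le> h" "0 \<le> t" "t \<le> h" for s t k l
    using near[OF that, of k l] d d3(2) by (auto simp: dist_commute)
  note diff = smooth_on_differentiable[OF \<open>open S\<close>]
  obtain s t where st: "0 < s" "s < h" "0 < t" "t < h" and
    1: "f (p + h *\<^sub>R axis i 1 + h *\<^sub>R axis j 1) - f (p + h *\<^sub>R axis i 1) - f (p + h *\<^sub>R axis j 1) + f p
       = h\<^sup>2 * ?D j i (p + s *\<^sub>R axis i 1 + t *\<^sub>R axis j 1)"
    by (rule mixed_difference[of h p i j S f]) (use h inS diff[OF \<open>smooth_on S f\<close>] diff[OF sm] in auto)
  obtain s' t' where st': "0 < s'" "s' < h" "0 < t'" "t' < h" and
    2: "f (p + h *\<^sub>R axis j 1 + h *\<^sub>R axis i 1) - f (p + h *\<^sub>R axis j 1) - f (p + h *\<^sub>R axis i 1) + f p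
       = h\<^sup>2 * ?D i j (p + s' *\<^sub>R axis j 1 + t' *\<^sub>R axis i 1)"
    by (rule mixed_difference[of h p j i S f]) (use h inS diff[OF \<open>smooth_on S f\<close>] diff[OF sm] in auto)
  have "?D j i (p + s *\<^sub>R axis i 1 + t *\<^sub>R axis j 1) = ?D i j (p + s' *\<^sub>R axis j 1 + t' *\<^sub>R axis i 1)"
  proof -
    have swap: "p + h *\<^sub>R axis j 1 + h *\<^sub>R axis i 1 = p + h *\<^sub>R axis i 1 + h *\<^sub>R axis j 1"
      by simp
    have "h\<^sup>2 * ?D j i (p + s *\<^sub>R axis i 1 + t *\<^sub>R axis j 1) =
        h\<^sup>2 * ?D i j (p + s' *\<^sub>R axis j 1 + t' *\<^sub>R axis i 1)"
      using 1 2[unfolded swap] by linarith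
    with h show ?thesis by simp
  qed
  moreover have "dist (?D j i (p + s *\<^sub>R axis i 1 + t *\<^sub>R axis j 1)) (?D j i p) < ?e"
    by (rule d2(2)) (use near[of s t i j] st d in auto)
  moreover have "dist (?D i j (p + s' *\<^sub>R axis j 1 + t' *\<^sub>R axis i 1)) (?D i j p) < ?e"
    by (rule d1(2)) (use near[of s' t' j i] st' d in auto)
  ultimately show False
    using dist_triangle3[of "?D i j p" "?D j i p" "?D i j (p + s' *\<^sub>R axis j 1 + t' *\<^sub>R axis i 1)"]
    by simp
qed

subsection \<open>Curvature and integrability\<close>

lemma half_plane_iff: "p \<in> half_plane \<longleftrightarrow> 0 < p $ 1"
  by (simp add: half_plane_def)

lemma open_half_plane: "open half_plane"
  unfolding half_plane_def by (intro open_Collect_less continuous_intros)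

lemma convex_half_plane: "convex half_plane"
  using convex_halfspace_gt[of 0 "axis 1 1 :: plane"]
  by (simp add: half_plane_def inner_axis inner_commute[of _ "axis _ _"] inner_axis')

lemma has_derivative_vec_nth [derivative_intros]:
  "(f has_derivative f') F \<Longrightarrow> ((\<lambda>x. f x $ i) has_derivative (\<lambda>v. f' v $ i)) F"
  by (rule bounded_linear.has_derivative[OF bounded_linear_vec_nth])

lemma nabla_frame: "nabla \<Gamma> (frame i) (frame j) p = (\<chi> k. \<Gamma> p i j k)"
  using exhaust_2[of i] exhaust_2[of j]
  by (auto simp: nabla_def vec_eq_iff deriv_along_def frame_def sum_2 axis_def)

text \<open>The curvature at x^1 = 1. The last two terms come from differentiating the factor 1/x^1
  of the Christoffel symbols, hence the tests for index 1.\<close>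

definition curv_coeff :: "christoffel \<Rightarrow> 2 \<Rightarrow> 2 \<Rightarrow> 2 \<Rightarrow> 2 \<Rightarrow> real" where
  "curv_coeff C i j k l =
     (\<Sum>m\<in>UNIV. C j k m * C i m l - C i k m * C j m l)
     - (if i = 1 then C j k l else 0) + (if j = 1 then C i k l else 0)"

lemma nabla_nabla_type_B:
  assumes "p \<in> half_plane"
  shows "nabla (type_B_conn C) (frame i) (nabla (type_B_conn C) (frame j) (frame k)) p $ l
    = ((\<Sum>m\<in>UNIV. C j k m * C i m l) - (if i = 1 then C j k l else 0)) / (p $ 1)\<^sup>2"
proof -
  let ?W = "\<chi> m. C j k m"
  have x: "p $ 1 > 0" using assms by (simp add: half_plane_iff)
  have n: "nabla (type_B_conn C) (frame j) (frame k) = (\<lambda>p. inverse (p $ 1) *\<^sub>R ?W)"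
    by (simp add: nabla_frame type_B_conn_def fun_eq_iff vec_eq_iff divide_inverse mult.commute)
  have "((\<lambda>p. inverse (p $ 1) *\<^sub>R ?W) has_derivative (\<lambda>v. - (v $ 1 / (p $ 1)\<^sup>2) *\<^sub>R ?W)) (at p)"
    using x by (auto intro!: derivative_eq_intros simp: power2_eq_square field_simps)
  from deriv_along_frame_eqI[OF this, of i]
  have d: "deriv_along (frame i) (\<lambda>p. inverse (p $ 1) *\<^sub>R ?W) p = - ((if i = 1 then 1 else 0) / (p $ 1)\<^sup>2) *\<^sub>R ?W"
    by (simp add: axis_def)
  have fr: "frame i p $ m = (if m = i then 1 else 0)" for m
    by (simp add: frame_def axis_def)
  show ?thesis
    unfolding n unfolding nabla_def d using exhaust_2[of i]
    by (auto simp: fr sum_2 type_B_conn_def power2_eq_square divide_inverse algebra_simps)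
qed

lemma curvature_type_B:
  assumes "p \<in> half_plane"
  shows "curvature (type_B_conn C) (frame i) (frame j) (frame k) p $ l = curv_coeff C i j k l / (p $ 1)\<^sup>2"
proof -
  have "lie_bracket (frame i) (frame j) = (\<lambda>p. 0)"
    by (simp add: lie_bracket_def deriv_along_def frame_def fun_eq_iff)
  then have "nabla (type_B_conn C) (lie_bracket (frame i) (frame j)) (frame k) p = 0"
    by (simp add: nabla_def deriv_along_def frame_def vec_eq_iff)
  then show ?thesis
    by (simp add: curvature_def nabla_nabla_type_B[OF assms] curv_coeff_def sum_subtractf
        diff_divide_distrib add_divide_distrib)
qed

definition ricci_sym_coeff :: "christoffel \<Rightarrow> 2 \<Rightarrow> 2 \<Rightarrow> real" where
  "ricci_sym_coeff C i j = (\<Sum>k\<in>UNIV. curv_coeff C k i j k + curv_coeff C k j i k) / 2"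

lemma ricci_sym_type_B:
  assumes "p \<in> half_plane"
  shows "ricci_sym (type_B_conn C) (frame i) (frame j) p = ricci_sym_coeff C i j / (p $ 1)\<^sup>2"
  by (simp add: ricci_sym_def ricci_def curvature_type_B[OF assms] ricci_sym_coeff_def sum_2
      add_divide_distrib mult.commute)

lemma flat_on_type_B:
  assumes "\<And>i j k l. curv_coeff C i j k l = 0"
  shows "flat_on half_plane (type_B_conn C)"
  by (simp add: flat_on_def vec_eq_iff curvature_type_B assms)

lemma hessian_type_B:
  assumes "f differentiable at p"
  shows "hessian (type_B_conn C) f (frame i) (frame j) p =
    deriv_along (frame i) (deriv_along (frame j) f) p
    - (\<Sum>k\<in>UNIV. C i j k * deriv_along (frame k) f p) / p $ 1"
proof -
  have "deriv_along (nabla (type_B_conn C) (frame i) (frame j)) f p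
      = (\<Sum>k\<in>UNIV. (C i j k / p $ 1) * deriv_along (frame k) f p)"
    using fun_cong[OF frechet_derivative_at[OF has_derivative_deriv_along[OF assms]],
        of "nabla (type_B_conn C) (frame i) (frame j) p"]
    by (simp add: nabla_frame deriv_along_def[of "nabla _ _ _"] type_B_conn_def)
  then show ?thesis
    by (simp add: hessian_def sum_divide_distrib)
qed

text \<open>
  With \<open>r = ricci_sym_coeff C\<close> this is the equation of \<open>\<AA>\<close> on the half plane, with \<open>r = 0\<close> the
  equation of \<open>ker H\<close>.
\<close>

definition potential_system :: "christoffel \<Rightarrow> (2 \<Rightarrow> 2 \<Rightarrow> real) \<Rightarrow> (plane \<Rightarrow> real) \<Rightarrow> bool" where
  "potential_system C r f \<longleftrightarrow> smooth_on half_plane f \<and>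
     (\<forall>p\<in>half_plane. \<forall>i j. deriv_along (frame i) (deriv_along (frame j) f) p =
        (\<Sum>k\<in>UNIV. C i j k * deriv_along (frame k) f p) / p $ 1 - r i j / (p $ 1)\<^sup>2)"

lemma soliton_potentials_type_B:
  "f \<in> soliton_potentials half_plane (type_B_conn C) \<longleftrightarrow>
     f \<in> extensional half_plane \<and> potential_system C (ricci_sym_coeff C) f"
proof -
  have "hessian (type_B_conn C) f (frame i) (frame j) p + ricci_sym (type_B_conn C) (frame i) (frame j) p = 0
    \<longleftrightarrow> deriv_along (frame i) (deriv_along (frame j) f) p =
        (\<Sum>k\<in>UNIV. C i j k * deriv_along (frame k) f p) / p $ 1 - ricci_sym_coeff C i j / (p $ 1)\<^sup>2"
    if "smooth_on half_plane f" "p \<in> half_plane" for p i j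
    unfolding hessian_type_B[OF smooth_on_differentiable[OF open_half_plane that]] ricci_sym_type_B[OF that(2)]
    by linarith
  then show ?thesis
    unfolding soliton_potentials_def potential_system_def by blast
qed

lemma potential_system_diff:
  assumes f: "potential_system C r f" and g: "potential_system C r g"
  shows "potential_system C (\<lambda>i j. 0) (\<lambda>p. f p - g p)"
proof -
  note smd = smooth_on_differentiable[OF open_half_plane]
  note smD = smooth_on_deriv_along[OF open_half_plane]
  have sf: "smooth_on half_plane f" and sg: "smooth_on half_plane g"
    using assms by (auto simp: potential_system_def)
  have D1: "deriv_along (frame i) (\<lambda>p. f p - g p) p = deriv_along (frame i) f p - deriv_along (frame i) g p"
    if "p \<in> half_plane" for i p
    by (rule deriv_along_diff[OF smd[OF sf that] smd[OF sg that]])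
  have D2: "deriv_along (frame i) (deriv_along (frame j) (\<lambda>p. f p - g p)) p
      = deriv_along (frame i) (deriv_along (frame j) f) p - deriv_along (frame i) (deriv_along (frame j) g) p"
    if p: "p \<in> half_plane" for i j p
  proof -
    let ?h = "\<lambda>p. deriv_along (frame j) f p - deriv_along (frame j) g p"
    have d: "deriv_along (frame j) f differentiable at p" "deriv_along (frame j) g differentiable at p"
      using smd[OF smD p] sf sg by auto
    have "deriv_along (frame i) (deriv_along (frame j) (\<lambda>p. f p - g p)) p = deriv_along (frame i) ?h p"
      by (rule deriv_along_frame_cong[OF open_half_plane p]) (use d D1 in auto)
    then show ?thesis using deriv_along_diff[OF d] by simp
  qed
  have "smooth_on half_plane (\<lambda>p. f p + - g p)"
    by (intro smooth_on_add open_half_plane sf smooth_on_bounded_linear[of uminus] sg bounded_linear_minus bounded_linear_ident)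
  then show ?thesis
    using f g by (simp add: potential_system_def D1 D2 right_diff_distrib sum_subtractf diff_divide_distrib)
qed

text \<open>
  The system is \<open>x \<partial>\<^sub>i P = C\<^sub>i P - r\<^sub>i / x\<close> for \<open>P = df\<close>. Equality of the mixed derivatives of \<open>P\<close> gives
  the first relation; its two derivatives give the others. Scaling \<open>P\<close> to \<open>u = x P\<close> removes \<open>x\<close>.
\<close>

lemma integrability:
  assumes "potential_system C r f" "p \<in> half_plane"
  defines "u \<equiv> \<lambda>k. p $ 1 * deriv_along (frame k) f p"
  defines "K \<equiv> \<lambda>j l. (\<Sum>m\<in>UNIV. C 1 j m * C 2 m l - C 2 j m * C 1 m l) + C 2 j l"
  defines "S \<equiv> \<lambda>j. (\<Sum>m\<in>UNIV. C 1 j m * r 2 m - C 2 j m * r 1 m) + 2 * r 2 j"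
  assumes sym: "\<And>i j k. C i j k = C j i k" "\<And>i j. r i j = r j i"
  shows "(\<Sum>l\<in>UNIV. K j l * u l) = S j"
    and "(\<Sum>l\<in>UNIV. K j l * ((\<Sum>m\<in>UNIV. C 1 l m * u m) - r 1 l)) = - S j"
    and "(\<Sum>l\<in>UNIV. K j l * ((\<Sum>m\<in>UNIV. C 2 l m * u m) - r 2 l)) = 0"
proof -
  let ?D = "\<lambda>k. deriv_along (frame k) f"
  have sf: "smooth_on half_plane f" and
    sys: "\<And>q i j. q \<in> half_plane \<Longrightarrow>
      deriv_along (frame i) (?D j) q = (\<Sum>k\<in>UNIV. C i j k * ?D k q) / q $ 1 - r i j / (q $ 1)\<^sup>2"
    using assms(1) by (auto simp: potential_system_def)
  have sD: "smooth_on half_plane (?D k)" for k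
    by (rule smooth_on_deriv_along[OF open_half_plane sf])
  have dD: "?D k differentiable at q" if "q \<in> half_plane" for k q
    by (rule smooth_on_differentiable[OF open_half_plane sD that])
  have third: "deriv_along (frame a) (deriv_along (frame i) (?D j)) q =
      (\<Sum>k\<in>UNIV. C i j k * deriv_along (frame a) (?D k) q) / q $ 1
       - (if a = 1 then (\<Sum>k\<in>UNIV. C i j k * ?D k q) / (q $ 1)\<^sup>2 - 2 * r i j / (q $ 1) ^ 3 else 0)"
    if q: "q \<in> half_plane" for a i j q
  proof -
    have x: "q $ 1 > 0" using q by (simp add: half_plane_iff)
    let ?F = "\<lambda>k. frechet_derivative (?D k) (at q)"
    have F: "(?D k has_derivative ?F k) (at q)" for k
      using dD[OF q] by (simp add: frechet_derivative_works)
    let ?R = "\<lambda>q. (\<Sum>k\<in>UNIV. C i j k * ?D k q) / q $ 1 - r i j / (q $ 1)\<^sup>2"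
    have R: "(?R has_derivative (\<lambda>v. (\<Sum>k\<in>UNIV. C i j k * ?F k v) / q $ 1
        - v $ 1 * ((\<Sum>k\<in>UNIV. C i j k * ?D k q) / (q $ 1)\<^sup>2 - 2 * r i j / (q $ 1) ^ 3))) (at q)"
      using x by (auto intro!: derivative_eq_intros F simp: power2_eq_square power3_eq_cube field_simps)
    have "deriv_along (frame a) (deriv_along (frame i) (?D j)) q = deriv_along (frame a) ?R q"
      by (rule deriv_along_frame_cong[OF open_half_plane q]) (use R sys in \<open>auto simp: differentiable_def\<close>)
    also have "\<dots> = (\<Sum>k\<in>UNIV. C i j k * ?F k (axis a 1)) / q $ 1
        - axis a 1 $ 1 * ((\<Sum>k\<in>UNIV. C i j k * ?D k q) / (q $ 1)\<^sup>2 - 2 * r i j / (q $ 1) ^ 3)"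
      by (rule deriv_along_frame_eqI[OF R])
    finally show ?thesis by (simp add: axis_def deriv_along_def frame_def)
  qed
  have E0: "(\<Sum>l\<in>UNIV. K j l * ?D l q) = S j / q $ 1" if q: "q \<in> half_plane" for q j
  proof -
    have x: "q $ 1 > 0" using q by (simp add: half_plane_iff)
    have "deriv_along (frame 2) (deriv_along (frame 1) (?D j)) q = deriv_along (frame 1) (deriv_along (frame 2) (?D j)) q"
      by (rule deriv_along_commute[OF open_half_plane sD q])
    \<comment> \<open>The system is substituted a second time for the remaining second derivatives.
      The summand \<open>C 2 j l\<close> of \<open>K\<close> and the summand
      \<open>2 * r 2 j\<close> of \<open>S\<close> are the traces of differentiating 1/x^1 and
      1/(x^1)^2 in direction 1.\<close>
    then have "(inverse (q $ 1))\<^sup>2 * ((\<Sum>l\<in>UNIV. K j l * ?D l q) - S j * inverse (q $ 1)) = 0"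
      unfolding third[OF q] sys[OF q] K_def S_def sum_2 divide_inverse power_inverse[symmetric]
      by (simp add: algebra_simps power2_eq_square power3_eq_cube)
    with x show ?thesis by (simp add: divide_inverse)
  qed
  have E1: "(\<Sum>l\<in>UNIV. K j l * deriv_along (frame a) (?D l) p) = - (if a = 1 then S j / (p $ 1)\<^sup>2 else 0)" for a
  proof -
    have x: "p $ 1 > 0" using assms by (simp add: half_plane_iff)
    let ?F = "\<lambda>k. frechet_derivative (?D k) (at p)"
    have F: "(?D k has_derivative ?F k) (at p)" for k
      using dD[OF \<open>p \<in> half_plane\<close>] by (simp add: frechet_derivative_works)
    have L: "((\<lambda>q. \<Sum>l\<in>UNIV. K j l * ?D l q) has_derivative (\<lambda>v. \<Sum>l\<in>UNIV. K j l * ?F l v)) (at p)"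
      by (auto intro!: derivative_eq_intros F)
    have R: "((\<lambda>q. S j / q $ 1) has_derivative (\<lambda>v. - v $ 1 * (S j / (p $ 1)\<^sup>2))) (at p)"
      using x by (auto intro!: derivative_eq_intros simp: power2_eq_square field_simps)
    have "deriv_along (frame a) (\<lambda>q. \<Sum>l\<in>UNIV. K j l * ?D l q) p = deriv_along (frame a) (\<lambda>q. S j / q $ 1) p"
      by (rule deriv_along_frame_cong[OF open_half_plane \<open>p \<in> half_plane\<close>]) (use R E0 in \<open>auto simp: differentiable_def\<close>)
    then show ?thesis
      unfolding deriv_along_frame_eqI[OF L] deriv_along_frame_eqI[OF R]
      by (simp add: axis_def deriv_along_def frame_def)
  qed
  have x: "p $ 1 > 0" using assms by (simp add: half_plane_iff)
  show "(\<Sum>l\<in>UNIV. K j l * u l) = S j"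
    using E0[OF \<open>p \<in> half_plane\<close>, of j] x by (simp add: u_def sum_2 field_simps)
  \<comment> \<open>By the system the vector in the second and third claims is a rescaled derivative
    of df, so the differentiated relation \<open>E1\<close> applies to it.\<close>
  have u: "(\<Sum>m\<in>UNIV. C a l m * u m) - r a l = (p $ 1)\<^sup>2 * deriv_along (frame a) (?D l) p" for a l
    unfolding sys[OF \<open>p \<in> half_plane\<close>] u_def sum_2 using x
    by (simp add: field_simps power2_eq_square)
  have E1': "(\<Sum>l\<in>UNIV. K j l * ((\<Sum>m\<in>UNIV. C a l m * u m) - r a l)) = (p $ 1)\<^sup>2 * - (if a = 1 then S j / (p $ 1)\<^sup>2 else 0)" for a
    unfolding u E1[of a, symmetric] by (simp add: sum_distrib_left mult.left_commute)
  show "(\<Sum>l\<in>UNIV. K j l * ((\<Sum>m\<in>UNIV. C 1 l m * u m) - r 1 l)) = - S j"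
    using E1'[of 1] x by simp
  show "(\<Sum>l\<in>UNIV. K j l * ((\<Sum>m\<in>UNIV. C 2 l m * u m) - r 2 l)) = 0"
    using E1'[of 2] x by simp
qed

subsection \<open>Kernel of the Hessian and linear equivalence\<close>

text \<open>\<open>P\<close> is a formula for the gradient valid on the half plane and
  \<open>Q\<close> its derivative; \<open>f\<close> may be arbitrary elsewhere, as restricted
  functions are.\<close>

lemma potential_systemI:
  assumes "smooth_on half_plane f"
    and "\<And>p k. p \<in> half_plane \<Longrightarrow> deriv_along (frame k) f p = P k p"
    and "\<And>p j. p \<in> half_plane \<Longrightarrow> (P j has_derivative Q j p) (at p)"
    and "\<And>p i j. p \<in> half_plane \<Longrightarrow>
      Q j p (axis i 1) = (\<Sum>k\<in>UNIV. C i j k * P k p) / p $ 1 - r i j / (p $ 1)\<^sup>2"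
  shows "potential_system C r f"
proof -
  have "deriv_along (frame i) (deriv_along (frame j) f) p = Q j p (axis i 1)" if p: "p \<in> half_plane" for p i j
  proof -
    have "deriv_along (frame i) (deriv_along (frame j) f) p = deriv_along (frame i) (P j) p"
      by (rule deriv_along_frame_cong[OF open_half_plane p])
        (use assms(2) assms(3)[OF p, of j] p in \<open>auto simp: differentiable_def\<close>)
    also have "\<dots> = Q j p (axis i 1)" by (rule deriv_along_frame_eqI[OF assms(3)[OF p]])
    finally show ?thesis .
  qed
  with assms show ?thesis by (simp add: potential_system_def)
qed

lemma potential_system_add_const:
  assumes f: "potential_system C r f" and g: "\<And>p. p \<in> half_plane \<Longrightarrow> g p = f p + t"
  shows "potential_system C r g"
proof (rule potential_systemI[where P = "\<lambda>k. deriv_along (frame k) f"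
      and Q = "\<lambda>j p. frechet_derivative (deriv_along (frame j) f) (at p)"])
  have sf: "smooth_on half_plane f" using f by (simp add: potential_system_def)
  show "smooth_on half_plane g"
    by (rule smooth_on_cong[OF open_half_plane smooth_on_add[OF open_half_plane sf smooth_on_const[OF open_half_plane, of t]]])
      (simp add: g)
  fix p :: plane assume p: "p \<in> half_plane"
  have F: "((\<lambda>p. f p + t) has_derivative frechet_derivative f (at p)) (at p)"
    using has_derivative_add_const smooth_on_differentiable[OF open_half_plane sf p] frechet_derivative_works by blast
  have "deriv_along (frame k) g p = deriv_along (frame k) (\<lambda>p. f p + t) p" for k
    by (rule deriv_along_frame_cong[OF open_half_plane p]) (use F g in \<open>auto simp: differentiable_def\<close>)
  then show "deriv_along (frame k) g p = deriv_along (frame k) f p" for k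
    using deriv_along_frame_eqI[OF F] by (simp add: deriv_along_def frame_def)
  show "(deriv_along (frame j) f has_derivative frechet_derivative (deriv_along (frame j) f) (at p)) (at p)" for j
    using smooth_on_differentiable[OF open_half_plane smooth_on_deriv_along[OF open_half_plane sf] p]
    by (simp add: frechet_derivative_works)
  show "frechet_derivative (deriv_along (frame j) f) (at p) (axis i 1) =
       (\<Sum>k\<in>UNIV. C i j k * deriv_along (frame k) f p) / p $ 1 - r i j / (p $ 1)\<^sup>2" for i j
    using f p by (simp add: potential_system_def deriv_along_def frame_def)
qed

lemma constant_on_half_plane:
  fixes h :: "plane \<Rightarrow> real"
  assumes "smooth_on half_plane h" "\<And>p k. p \<in> half_plane \<Longrightarrow> deriv_along (frame k) h p = 0"
  obtains t where "\<And>p. p \<in> half_plane \<Longrightarrow> h p = t"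
proof -
  have "(h has_derivative (\<lambda>v. 0)) (at p within half_plane)" if p: "p \<in> half_plane" for p
    using has_derivative_deriv_along[OF smooth_on_differentiable[OF open_half_plane assms(1) p]] assms(2)[OF p]
    by (simp add: has_derivative_at_withinI)
  then show thesis
    using has_derivative_zero_constant[OF convex_half_plane, of h] that by blast
qed

text \<open>If every difference of a potential with a fixed \<open>f\<close> had zero gradient, the
  differences would be constants, and since constants may be added freely the space would be exactly
  f + R, an affine line. The point \<open>p\<close> is where the classification is carried
  out.\<close>

lemma nonconstant_difference:
  assumes "soliton_potentials half_plane (type_B_conn C) \<noteq> {}"
    and "\<not> is_affine_line half_plane (soliton_potentials half_plane (type_B_conn C))"
  obtains f h p k where "potential_system C (ricci_sym_coeff C) f" "potential_system C (\<lambda>i j. 0) h"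
    "p \<in> half_plane" "deriv_along (frame k) h p \<noteq> 0"
proof -
  let ?A = "soliton_potentials half_plane (type_B_conn C)"
  obtain f where f: "f \<in> ?A" using assms(1) by blast
  have sysf: "potential_system C (ricci_sym_coeff C) f" and extf: "f \<in> extensional half_plane"
    using f by (auto simp: soliton_potentials_type_B)
  have "\<exists>g\<in>?A. \<exists>p\<in>half_plane. \<exists>k. deriv_along (frame k) (\<lambda>p. g p - f p) p \<noteq> 0"
  proof (rule ccontr)
    assume "\<not> ?thesis"
    then have zero: "\<And>g p k. g \<in> ?A \<Longrightarrow> p \<in> half_plane \<Longrightarrow> deriv_along (frame k) (\<lambda>p. g p - f p) p = 0"
      by blast
    have "?A = {(\<lambda>p\<in>half_plane. f p + t) | t. True}"
    proof (intro set_eqI iffI)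
      fix g assume g: "g \<in> ?A"
      have sg: "potential_system C (ricci_sym_coeff C) g" and eg: "g \<in> extensional half_plane"
        using g by (auto simp: soliton_potentials_type_B)
      have "smooth_on half_plane (\<lambda>p. g p - f p)"
        using potential_system_diff[OF sg sysf] by (simp add: potential_system_def)
      then obtain t where "\<And>p. p \<in> half_plane \<Longrightarrow> g p - f p = t"
        using constant_on_half_plane[OF _ zero[OF g]] by metis
      then have "g = (\<lambda>p\<in>half_plane. f p + t)"
        using eg by (intro extensionalityI[of _ half_plane]) (auto simp: algebra_simps)
      then show "g \<in> {(\<lambda>p\<in>half_plane. f p + t) | t. True}" by blast
    next
      fix g assume "g \<in> {(\<lambda>p\<in>half_plane. f p + t) | t. True}"
      then obtain t where "g = (\<lambda>p\<in>half_plane. f p + t)" by blast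
      then show "g \<in> ?A"
        unfolding soliton_potentials_type_B using potential_system_add_const[OF sysf, of g t] by simp
    qed
    with assms(2) show False by (auto simp: is_affine_line_def)
  qed
  then obtain g p k where "g \<in> ?A" "p \<in> half_plane" "deriv_along (frame k) (\<lambda>p. g p - f p) p \<noteq> 0"
    by blast
  with sysf show thesis
    using that[OF sysf potential_system_diff] by (auto simp: soliton_potentials_type_B)
qed

section \<open>The curvature matrix and the action of shears\<close>

text \<open>With \<open>C i\<close> read as a matrix acting on covectors, this is the commutator of
  \<open>C 1\<close> and \<open>C 2\<close> plus \<open>C 2\<close>. It is the \<open>K\<close> of
  the integrability conditions and, up to sign and the factor (x^1)^2, the operator R(\<partial>_1,
  \<partial>_2), which is the whole curvature of a surface.\<close>

definition type_B_curv :: "christoffel \<Rightarrow> 2 \<Rightarrow> 2 \<Rightarrow> real" where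
  "type_B_curv C j l = (\<Sum>m\<in>UNIV. C 1 j m * C 2 m l - C 2 j m * C 1 m l) + C 2 j l"

lemma curv_coeff_eq:
  "curv_coeff C i j k l = (if i = j then 0 else if i = 1 then - type_B_curv C k l else type_B_curv C k l)"
  using exhaust_2[of i] exhaust_2[of j]
  by (auto simp: curv_coeff_def type_B_curv_def sum_2)

lemma ricci_sym_coeff_eq:
  "ricci_sym_coeff C 1 1 = type_B_curv C 1 2"
  "ricci_sym_coeff C 1 2 = (type_B_curv C 2 2 - type_B_curv C 1 1) / 2"
  "ricci_sym_coeff C 2 1 = (type_B_curv C 2 2 - type_B_curv C 1 1) / 2"
  "ricci_sym_coeff C 2 2 = - type_B_curv C 2 1"
  by (auto simp: ricci_sym_coeff_def curv_coeff_eq sum_2)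

lemma shear_eq: "shear b c p $ 1 = p $ 1" "shear b c p $ 2 = b * p $ 1 + c * p $ 2"
  by (simp_all add: shear_def)

text \<open>The shear has constant differential with columns (1, b) and (0, c), so no second
  derivatives enter, and it preserves x^1, so the factor 1/x^1 drops out. The equations are the two
  components of the pullback condition on the pairs (1,1), (1,2) and (2,2).\<close>

lemma linearly_equivalentI:
  assumes "c \<noteq> 0" and sym: "\<And>i j k. C i j k = C j i k" "\<And>i j k. C' i j k = C' j i k"
    and "C' 1 1 1 = C 1 1 1 + 2 * b * C 1 2 1 + b\<^sup>2 * C 2 2 1"
      "b * C' 1 1 1 + c * C' 1 1 2 = C 1 1 2 + 2 * b * C 1 2 2 + b\<^sup>2 * C 2 2 2"
      "C' 1 2 1 = c * (C 1 2 1 + b * C 2 2 1)"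
      "b * C' 1 2 1 + c * C' 1 2 2 = c * (C 1 2 2 + b * C 2 2 2)"
      "C' 2 2 1 = c\<^sup>2 * C 2 2 1"
      "b * C' 2 2 1 + c * C' 2 2 2 = c\<^sup>2 * C 2 2 2"
  shows "linearly_equivalent C C'"
proof -
  let ?T = "\<lambda>k. if k = 1 then vector [1, b] else vector [0, c] :: plane"
  have "bounded_linear (shear b c)"
    by (intro linear_conv_bounded_linear[THEN iffD1] linearI)
      (auto simp: vec_eq_iff forall_2 shear_eq algebra_simps)
  then have "(shear b c has_derivative shear b c) (at p)" for p
    by (rule bounded_linear_imp_has_derivative)
  from deriv_along_frame_eqI[OF this]
  have D: "deriv_along (frame k) (shear b c) = (\<lambda>p. ?T k)" for k
    using exhaust_2[of k] by (auto simp: vec_eq_iff forall_2 shear_eq axis_def fun_eq_iff)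
  have DD: "deriv_along (frame i) (\<lambda>p. ?T k) p = 0" for i k p
    by (simp add: deriv_along_def)
  have "is_pullback half_plane (shear b c) (type_B_conn C) (type_B_conn C')"
    unfolding is_pullback_def D DD
  proof (intro ballI allI)
    fix p i j
    have "(\<Sum>k\<in>UNIV. C' i j k * ?T k $ m) = (\<Sum>a\<in>UNIV. \<Sum>b\<in>UNIV. C a b m * ?T i $ a * ?T j $ b)" for m
      using exhaust_2[of i] exhaust_2[of j] exhaust_2[of m] assms(4-9) sym(1)[of 2 1] sym(2)[of 2 1]
      by (auto simp: sum_2 algebra_simps power2_eq_square)
    then show "(\<Sum>k\<in>UNIV. type_B_conn C' p i j k *\<^sub>R ?T k) = 0 + (\<chi> m. \<Sum>ia\<in>UNIV. \<Sum>ja\<in>UNIV.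
        type_B_conn C (shear b c p) ia ja m * ?T i $ ia * ?T j $ ja)"
      by (simp add: vec_eq_iff type_B_conn_def shear_eq flip: sum_divide_distrib)
  qed
  with \<open>c \<noteq> 0\<close> show ?thesis by (auto simp: linearly_equivalent_def)
qed

lemma linearly_equivalent_refl: "(\<And>i j k. C i j k = C j i k) \<Longrightarrow> linearly_equivalent C C"
  by (rule linearly_equivalentI[of 1 _ _ 0]) auto

subsection \<open>Type A coordinates\<close>

text \<open>The witness is the sequence of successive derivatives; passing to an antiderivative then
  amounts to prepending one term.\<close>

definition smooth_real :: "real set \<Rightarrow> (real \<Rightarrow> real) \<Rightarrow> bool" where
  "smooth_real I g \<longleftrightarrow> (\<exists>s. s 0 = g \<and> (\<forall>n. \<forall>x\<in>I. (s n has_real_derivative s (Suc n) x) (at x)))"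

lemma smooth_real_antiderivative:
  assumes "smooth_real I g'" "\<And>x. x \<in> I \<Longrightarrow> (g has_real_derivative g' x) (at x)"
  shows "smooth_real I g"
proof -
  obtain s where "s 0 = g'" "\<forall>n. \<forall>x\<in>I. (s n has_real_derivative s (Suc n) x) (at x)"
    using assms(1) by (auto simp: smooth_real_def)
  then have "\<forall>n. \<forall>x\<in>I. (case_nat g s n has_real_derivative case_nat g s (Suc n) x) (at x)"
    using assms(2) by (auto split: nat.split)
  then show ?thesis unfolding smooth_real_def by (intro exI[of _ "case_nat g s"]) simp
qed

lemma smooth_real_const: "smooth_real I (\<lambda>x. k)"
  unfolding smooth_real_def
  by (intro exI[of _ "case_nat (\<lambda>x. k) (\<lambda>n x. 0)"]) (auto split: nat.split)

lemma smooth_real_linear: "smooth_real I (\<lambda>x. k * x)"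
  by (rule smooth_real_antiderivative[OF smooth_real_const[of _ k]]) (auto intro!: derivative_eq_intros)

text \<open>Each differentiation adds \<open>k\<close> to the constant term. The family contains exp
  itself and what the functions x and x log x - x become under x = exp u.\<close>

lemma smooth_real_affine_exp: "smooth_real I (\<lambda>x. (k * x + m) * exp x)"
  unfolding smooth_real_def
  by (intro exI[of _ "\<lambda>n x. (k * x + (m + real n * k)) * exp x"])
    (auto intro!: derivative_eq_intros simp: algebra_simps)

lemma smooth_real_ln: "smooth_real {0<..} (\<lambda>x. k * ln x)"
proof (rule smooth_real_antiderivative)
  show "smooth_real {0<..} (\<lambda>x. k * inverse x)"
    unfolding smooth_real_def
  proof (intro exI[of _ "\<lambda>n x. k * (-1) ^ n * fact n * inverse x ^ Suc n"] conjI allI ballI)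
    show "((\<lambda>x. k * (-1) ^ n * fact n * inverse x ^ Suc n) has_real_derivative
        k * (-1) ^ Suc n * fact (Suc n) * inverse x ^ Suc (Suc n)) (at x)" if "x \<in> {0<..}" for n x
      using that by (auto intro!: derivative_eq_intros simp: power2_eq_square algebra_simps simp del: power_Suc)
        (simp add: algebra_simps)
  qed simp
qed (auto intro!: derivative_eq_intros simp: divide_inverse)

lemma smooth_real_x_ln: "smooth_real {0<..} (\<lambda>x. k * (x * ln x - x))"
  by (rule smooth_real_antiderivative[OF smooth_real_ln[of k]]) (auto intro!: derivative_eq_intros)

text \<open>Every component of every explicit map and potential below is a sum of functions of this
  shape.\<close>

lemma smooth_on_fst_plus:
  assumes "open S" "\<And>p. p \<in> S \<Longrightarrow> p $ 1 \<in> I" "smooth_real I g"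
  shows "smooth_on S (\<lambda>p. g (p $ 1) + k * p $ 2)"
proof -
  obtain s where s0: "s 0 = g" and s: "\<And>n x. x \<in> I \<Longrightarrow> (s n has_real_derivative s (Suc n) x) (at x)"
    using assms(3) by (auto simp: smooth_real_def)
  \<comment> \<open>The free constant term makes the class closed under the derivative in direction
    2, which is constant.\<close>
  define X where "X f \<longleftrightarrow> (\<exists>n \<alpha> \<beta> \<gamma>. f = (\<lambda>p::plane. \<alpha> * s n (p $ 1) + \<beta> * p $ 2 + \<gamma>))" for f
  have X: "X (\<lambda>p. \<alpha> * s n (p $ 1) + \<beta> * p $ 2 + \<gamma>)" for n \<alpha> \<beta> \<gamma>
    unfolding X_def by blast
  show ?thesis
  proof (rule smooth_on_coinduct[where X = X, OF \<open>open S\<close>])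
    show "X (\<lambda>p. g (p $ 1) + k * p $ 2)"
      using X[of 1 0 k 0] by (simp add: s0)
    fix f assume "X f"
    then obtain n \<alpha> \<beta> \<gamma> where f: "f = (\<lambda>p::plane. \<alpha> * s n (p $ 1) + \<beta> * p $ 2 + \<gamma>)"
      unfolding X_def by blast
    let ?f' = "\<lambda>(p::plane) (v::plane). \<alpha> * (s (Suc n) (p $ 1) * v $ 1) + \<beta> * v $ 2"
    have "(f has_derivative ?f' p) (at p)" if "p \<in> S" for p
    proof -
      have "((\<lambda>p::plane. s n (p $ 1)) has_derivative (\<lambda>v. s (Suc n) (p $ 1) * v $ 1)) (at p)"
        by (rule has_derivative_compose[where f = "\<lambda>p. p $ 1"])
          (use s[OF assms(2)[OF that], of n] in \<open>auto intro!: derivative_eq_intros simp: has_field_derivative_def\<close>)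
      then show ?thesis unfolding f by (auto intro!: derivative_eq_intros)
    qed
    moreover have "\<exists>h. X h \<and> (\<forall>p\<in>S. ?f' p (axis i 1) = h p)" for i
    proof (cases "i = 1")
      case True
      show ?thesis
        by (intro exI[of _ "\<lambda>p. \<alpha> * s (Suc n) (p $ 1) + 0 * p $ 2 + 0"] conjI)
          (rule X, simp add: True axis_def)
    next
      case False
      then have "i = 2" using exhaust_2 by blast
      show ?thesis
        by (intro exI[of _ "\<lambda>p. 0 * s n (p $ 1) + 0 * p $ 2 + \<beta>"] conjI)
          (rule X, simp add: \<open>i = 2\<close> axis_def)
    qed
    ultimately show "\<exists>g'. (\<forall>p\<in>S. (f has_derivative g' p) (at p)) \<and>
           (\<forall>i. \<exists>h. X h \<and> (\<forall>p\<in>S. g' p (axis i 1) = h p))"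
      by (intro exI[of _ ?f']) blast
  qed
qed

lemma vector_2_eq: "(vector [a, b] :: plane) = a *\<^sub>R axis 1 1 + b *\<^sub>R axis 2 1"
  by (simp add: vec_eq_iff forall_2 axis_def)

lemma smooth_on_vector_2:
  assumes "open S" "smooth_on S f" "smooth_on S g"
  shows "smooth_on S (\<lambda>p. vector [f p, g p] :: plane)"
  unfolding vector_2_eq
  by (intro smooth_on_add assms smooth_on_bounded_linear[of "\<lambda>x. x *\<^sub>R _"] bounded_linear_scaleR_left)

lemma has_derivative_vector_2:
  assumes "(f has_derivative f') F" "(g has_derivative g') F"
  shows "((\<lambda>p. vector [f p, g p] :: plane) has_derivative (\<lambda>v. vector [f' v, g' v])) F"
  unfolding vector_2_eq by (intro derivative_intros assms)

text \<open>The maps (x^1, x^2) to (l x^1, l x^2 + t) with l > 0 act transitively on the half plane.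
  They preserve the connection because its Christoffel symbols are homogeneous of degree -1 and do
  not involve x^2.\<close>

lemma locally_homogeneous_type_B: "locally_homogeneous half_plane (type_B_conn C)"
  unfolding locally_homogeneous_def
proof (intro ballI)
  fix p q assume p: "p \<in> half_plane" and q: "q \<in> half_plane"
  \<comment> \<open>The summand \<open>0 * z $ 2\<close> only brings the component into the shape of
    \<open>smooth_on_fst_plus\<close>.\<close>
  define A :: "real \<Rightarrow> real \<Rightarrow> plane \<Rightarrow> plane" where
    "A = (\<lambda>l t z. vector [l * z $ 1 + 0 * z $ 2, t + l * z $ 2])"
  have smA: "smooth_on half_plane (A l t)" for l t
    unfolding A_def
    by (intro smooth_on_vector_2 open_half_plane smooth_on_fst_plus[where I = UNIV]
        smooth_on_fst_plus[where g = "\<lambda>_. _" and I = UNIV] smooth_real_linear smooth_real_const UNIV_I)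
  have A1: "A l t z $ 1 = l * z $ 1" and A2: "A l t z $ 2 = t + l * z $ 2" for l t z
    by (simp_all add: A_def)
  define l where "l = q $ 1 / p $ 1"
  define t where "t = q $ 2 - l * p $ 2"
  have l: "l > 0" using p q by (simp add: l_def half_plane_iff)
  have inv: "A (inverse l) (- t / l) (A l t z) = z" "A l t (A (inverse l) (- t / l) z) = z" for z
    using l by (simp_all add: vec_eq_iff forall_2 A1 A2 field_simps)
  have maps: "A l t z \<in> half_plane" "A (inverse l) (- t / l) z \<in> half_plane" if "z \<in> half_plane" for z
    using that l by (simp_all add: half_plane_iff A1)
  have "A l t ` half_plane = half_plane" "A (inverse l) (- t / l) ` half_plane = half_plane"
    using maps inv by (metis image_eqI image_subsetI subsetI subset_antisym)+
  then have "diffeo half_plane half_plane (A l t)"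
    unfolding diffeo_def using smA inv open_half_plane by blast
  moreover have "A l t p = q"
    using p by (simp add: vec_eq_iff forall_2 A1 A2 l_def t_def half_plane_iff)
  moreover have "is_pullback half_plane (A l t) (type_B_conn C) (type_B_conn C)"
  proof -
    have "(A l t has_derivative (\<lambda>v. vector [l * v $ 1 + 0 * v $ 2, l * v $ 2])) (at z)" for z
      unfolding A_def by (rule has_derivative_vector_2) (auto intro!: derivative_eq_intros)
    from deriv_along_frame_eqI[OF this]
    have D: "deriv_along (frame k) (A l t) = (\<lambda>z. l *\<^sub>R axis k 1)" for k
      by (auto simp: vec_eq_iff forall_2)
    have DD: "deriv_along (frame i) (\<lambda>z. l *\<^sub>R axis k 1 :: plane) z = 0" for i k z
      by (simp add: deriv_along_def)
    show ?thesis
      unfolding is_pullback_def D DD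
    proof (intro ballI allI)
      fix z i j assume "z \<in> half_plane"
      then show "(\<Sum>k\<in>UNIV. type_B_conn C z i j k *\<^sub>R l *\<^sub>R axis k 1) = 0 + (\<chi> m. \<Sum>a\<in>UNIV. \<Sum>b\<in>UNIV.
          type_B_conn C (A l t z) a b m * (l *\<^sub>R axis i 1 :: plane) $ a * (l *\<^sub>R axis j 1 :: plane) $ b)"
        using l exhaust_2[of i] exhaust_2[of j]
        by (auto simp: vec_eq_iff forall_2 sum_2 axis_def type_B_conn_def A1 half_plane_iff)
    qed
  qed
  ultimately show "\<exists>U V \<phi>. p \<in> U \<and> U \<subseteq> half_plane \<and> V \<subseteq> half_plane \<and> diffeo U V \<phi> \<and> \<phi> p = q \<and>
      is_pullback U \<phi> (type_B_conn C) (type_B_conn C)"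
    using p by blast
qed

text \<open>
  In the coordinates \<open>(log x\<^sup>1, x\<^sup>2 + G(x\<^sup>1))\<close> all Christoffel symbols but the second component of
  \<open>\<nabla>\<^sub>\<partial>\<^sub>1 \<partial>\<^sub>1\<close> are constant for any \<open>G\<close>; the differential equation makes that component vanish.
\<close>

lemma constant_christoffel_coordinates:
  fixes C :: christoffel and G G1 G2 :: "real \<Rightarrow> real"
  assumes sym: "\<And>i j k. C i j k = C j i k"
    and C: "C 1 2 1 = 0" "C 2 2 1 = 0" "C 2 2 2 = 0"
    and smooth: "smooth_real {0<..} G" "smooth_real UNIV (\<lambda>u. - G (exp u))"
    and G: "\<And>x. x > 0 \<Longrightarrow> (G has_real_derivative G1 x) (at x)"
      "\<And>x. x > 0 \<Longrightarrow> (G1 has_real_derivative G2 x) (at x)"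
    and eq: "\<And>x. x > 0 \<Longrightarrow> x * G2 x = (C 1 1 1 - 2 * C 1 2 2) * G1 x + C 1 1 2"
  shows "\<exists>V \<phi> (C'::christoffel). diffeo half_plane V \<phi> \<and> is_pullback half_plane \<phi> (\<lambda>_. C') (type_B_conn C)"
proof -
  define \<phi> :: "plane \<Rightarrow> plane" where "\<phi> = (\<lambda>p. vector [1 * ln (p $ 1) + 0 * p $ 2, G (p $ 1) + 1 * p $ 2])"
  define \<psi> :: "plane \<Rightarrow> plane" where
    "\<psi> = (\<lambda>p. vector [(0 * p $ 1 + 1) * exp (p $ 1) + 0 * p $ 2, - G (exp (p $ 1)) + 1 * p $ 2])"
  have "smooth_on half_plane \<phi>"
    unfolding \<phi>_def
    by (intro smooth_on_vector_2 open_half_plane smooth_on_fst_plus[where I = "{0<..}" and g = "\<lambda>x. 1 * ln x"]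
        smooth_on_fst_plus[where I = "{0<..}" and g = G] smooth_real_ln smooth(1)) (auto simp: half_plane_iff)
  moreover have "smooth_on UNIV \<psi>"
    unfolding \<psi>_def
    by (intro smooth_on_vector_2 open_UNIV smooth_on_fst_plus[where I = UNIV and g = "\<lambda>x. (0 * x + 1) * exp x"]
        smooth_on_fst_plus[where I = UNIV and g = "\<lambda>u. - G (exp u)"] smooth_real_affine_exp smooth(2)) auto
  moreover have inv: "\<psi> (\<phi> p) = p" if "p \<in> half_plane" for p
    using that by (simp add: vec_eq_iff forall_2 \<phi>_def \<psi>_def half_plane_iff)
  moreover have inv': "\<phi> (\<psi> q) = q" for q
    by (simp add: vec_eq_iff forall_2 \<phi>_def \<psi>_def)
  moreover have psi: "\<psi> q \<in> half_plane" for q by (simp add: \<psi>_def half_plane_iff)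
  moreover have "\<phi> ` half_plane = UNIV" "\<psi> ` UNIV = half_plane"
    using inv inv' psi by (metis UNIV_eq_I rev_image_eqI, metis UNIV_I image_eqI image_subsetI subsetI subset_antisym)
  ultimately have "diffeo half_plane UNIV \<phi>"
    unfolding diffeo_def using open_half_plane open_UNIV by blast
  \<comment> \<open>The 1 added to \<open>C 1 1 1\<close> compensates the second derivative of log
    x^1.\<close>
  moreover have "is_pullback half_plane \<phi>
      (\<lambda>_ i j k. if i = 1 \<and> j = 1 then (if k = 1 then C 1 1 1 + 1 else 0)
                 else if i = 2 \<and> j = 2 then 0 else if k = 1 then 0 else C 1 2 2) (type_B_conn C)"
  proof -
    let ?P = "\<lambda>j (p::plane). if j = 1 then vector [1 / p $ 1, G1 (p $ 1)] else vector [0, 1] :: plane"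
    have Gp: "((\<lambda>p::plane. g (p $ 1)) has_derivative (\<lambda>v. d * v $ 1)) (at p)"
      if "(g has_real_derivative d) (at (p $ 1))" for p g d
      by (rule has_derivative_compose[where f = "\<lambda>p. p $ 1"])
        (use that in \<open>auto intro!: derivative_eq_intros simp: has_field_derivative_def\<close>)
    have "(\<phi> has_derivative (\<lambda>v. vector [v $ 1 / p $ 1, G1 (p $ 1) * v $ 1 + v $ 2])) (at p)"
      if "p \<in> half_plane" for p
      unfolding \<phi>_def using that
      by (intro has_derivative_vector_2) (auto intro!: derivative_eq_intros Gp G simp: half_plane_iff field_simps)
    from deriv_along_frame_eqI[OF this]
    have D: "deriv_along (frame k) \<phi> p = ?P k p" if "p \<in> half_plane" for k p
      using exhaust_2[of k] that by (auto simp: vec_eq_iff forall_2 axis_def)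
    have P: "(?P k has_derivative (\<lambda>v. if k = 1 then vector [- (v $ 1) / (p $ 1)\<^sup>2, G2 (p $ 1) * v $ 1] else 0)) (at p)"
      if "p \<in> half_plane" for k p
    proof (cases "k = 1")
      case True
      have "((\<lambda>p. vector [1 / p $ 1, G1 (p $ 1)] :: plane) has_derivative
          (\<lambda>v. vector [- (v $ 1) / (p $ 1)\<^sup>2, G2 (p $ 1) * v $ 1])) (at p)"
      proof (rule has_derivative_vector_2)
        show "((\<lambda>p. 1 / p $ 1) has_derivative (\<lambda>v. - (v $ 1) / (p $ 1)\<^sup>2)) (at p)"
          using that by (auto intro!: derivative_eq_intros simp: half_plane_iff power2_eq_square field_simps)
        show "((\<lambda>p. G1 (p $ 1)) has_derivative (\<lambda>v. G2 (p $ 1) * v $ 1)) (at p)"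
          using that by (intro Gp G) (simp add: half_plane_iff)
      qed
      with True show ?thesis by simp
    qed simp
    have DD: "deriv_along (frame i) (deriv_along (frame j) \<phi>) p =
        (if i = 1 \<and> j = 1 then vector [- 1 / (p $ 1)\<^sup>2, G2 (p $ 1)] else 0)" if p: "p \<in> half_plane" for i j p
    proof -
      have "deriv_along (frame i) (deriv_along (frame j) \<phi>) p = deriv_along (frame i) (?P j) p"
        by (rule deriv_along_frame_cong[OF open_half_plane p])
          (use D P[OF p, of j] p in \<open>auto simp: differentiable_def\<close>)
      also have "\<dots> = (if i = 1 \<and> j = 1 then vector [- 1 / (p $ 1)\<^sup>2, G2 (p $ 1)] else 0)"
        unfolding deriv_along_frame_eqI[OF P[OF p]] using exhaust_2[of i]
        by (auto simp: vec_eq_iff forall_2 axis_def)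
      finally show ?thesis .
    qed
    show ?thesis
      unfolding is_pullback_def
    proof (intro ballI allI)
      fix p i j assume p: "p \<in> half_plane"
      then have x: "p $ 1 > 0" by (simp add: half_plane_iff)
      have "G2 (p $ 1) = ((C 1 1 1 - 2 * C 1 2 2) * G1 (p $ 1) + C 1 1 2) / p $ 1"
        using eq[OF x] x by (simp add: field_simps)
      then show "(\<Sum>k\<in>UNIV. type_B_conn C p i j k *\<^sub>R deriv_along (frame k) \<phi> p) =
        deriv_along (frame i) (deriv_along (frame j) \<phi>) p + (\<chi> m. \<Sum>a\<in>UNIV. \<Sum>b\<in>UNIV.
          (if a = 1 \<and> b = 1 then if m = 1 then C 1 1 1 + 1 else 0
           else if a = 2 \<and> b = 2 then 0 else if m = 1 then 0 else C 1 2 2) *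
          deriv_along (frame i) \<phi> p $ a * deriv_along (frame j) \<phi> p $ b)"
        unfolding D[OF p] DD[OF p] using exhaust_2[of i] exhaust_2[of j] C sym[of 2 1] x
        by (auto simp: vec_eq_iff forall_2 sum_2 type_B_conn_def field_simps power2_eq_square)
    qed
  qed
  ultimately show ?thesis by blast
qed

text \<open>The equation for G is linear of first order in G'. It has a constant solution G' unless
  the coefficient \<open>C 1 1 1 - 2 * C 1 2 2\<close> vanishes; in that resonant case G' is a
  multiple of the logarithm. A single chart covers the half plane either way.\<close>

lemma type_A_type_B_conn:
  assumes sym: "\<And>i j k. C i j k = C j i k"
    and C: "C 1 2 1 = 0" "C 2 2 1 = 0" "C 2 2 2 = 0"
    and "\<not> flat_on half_plane (type_B_conn C)"
  shows "type_A half_plane (type_B_conn C)"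
proof -
  have "\<exists>V \<phi> (C'::christoffel). diffeo half_plane V \<phi> \<and> is_pullback half_plane \<phi> (\<lambda>_. C') (type_B_conn C)"
  proof (cases "C 1 1 1 = 2 * C 1 2 2")
    case True
    show ?thesis
    proof (rule constant_christoffel_coordinates[OF sym C, of "\<lambda>x. C 1 1 2 * (x * ln x - x)"
          "\<lambda>x. C 1 1 2 * ln x" "\<lambda>x. C 1 1 2 / x"])
      show "smooth_real UNIV (\<lambda>u. - (C 1 1 2 * (exp u * ln (exp u) - exp u)))"
        using smooth_real_affine_exp[of UNIV "- C 1 1 2" "C 1 1 2"] by (simp add: algebra_simps)
    qed (use True in \<open>auto intro!: smooth_real_x_ln derivative_eq_intros\<close>)
  next
    case False
    define k where "k = - C 1 1 2 / (C 1 1 1 - 2 * C 1 2 2)"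
    show ?thesis
    proof (rule constant_christoffel_coordinates[OF sym C, of "\<lambda>x. k * x" "\<lambda>x. k" "\<lambda>x. 0"])
      show "smooth_real UNIV (\<lambda>u. - (k * exp u))"
        using smooth_real_affine_exp[of UNIV 0 "- k"] by simp
      show "x * 0 = (C 1 1 1 - 2 * C 1 2 2) * k + C 1 1 2" for x :: real
        using False by (simp add: k_def)
    qed (auto intro!: smooth_real_linear derivative_eq_intros)
  qed
  then show ?thesis
    unfolding type_A_def using assms(5) locally_homogeneous_type_B by blast
qed

subsection \<open>Potentials of the exceptional surfaces\<close>

text \<open>All \<open>C i j\<close> contract to zero with the covector (k, 1), so x^2 + k x^1 has
  zero Hessian. The relations \<open>rel\<close> make the symmetrised Ricci tensor diagonal with
  exactly the entries that (a - 1) log x^1 absorbs. One family thus serves both exceptional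
  surfaces.\<close>

lemma soliton_potentials_log_linear:
  fixes a e k :: real
  assumes sym: "\<And>i j k. C i j k = C j i k"
    and C: "C 1 1 1 = a" "C 1 1 2 = - k * a" "C 1 2 1 = 0" "C 1 2 2 = 0" "C 2 2 1 = e" "C 2 2 2 = - k * e"
    and ne: "e \<noteq> 0" "a \<noteq> 1"
    and rel: "k * (2 * a - 1) = 0" "a * k\<^sup>2 * e = (a + 1) * (a - 1)"
  shows "soliton_potentials half_plane (type_B_conn C) =
    {(\<lambda>p\<in>half_plane. (a - 1) * ln (p $ 1) + c1 * (p $ 2 + k * p $ 1) + c0) | c0 c1. True}"
proof (intro set_eqI iffI)
  have K: "type_B_curv C 1 1 = - a * k * e" "type_B_curv C 1 2 = a * k\<^sup>2 * e"
    "type_B_curv C 2 1 = e * (1 - a)" "type_B_curv C 2 2 = - k * e * (1 - a)"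
    by (simp_all add: type_B_curv_def sum_2 C sym[of 2 1] power2_eq_square algebra_simps)
  have ke: "k * a * e = k * e / 2"
    using rel(1) by (simp add: algebra_simps)
  have r: "ricci_sym_coeff C 1 1 = (a + 1) * (a - 1)" "ricci_sym_coeff C 1 2 = 0"
    "ricci_sym_coeff C 2 1 = 0" "ricci_sym_coeff C 2 2 = e * (a - 1)"
    using rel ke by (simp_all add: ricci_sym_coeff_eq K algebra_simps)
  have sys: "potential_system C (ricci_sym_coeff C) f \<and> (\<forall>p\<in>half_plane. deriv_along (frame 2) f p = c1)"
    if f: "\<And>p. p \<in> half_plane \<Longrightarrow> f p = (a - 1) * ln (p $ 1) + c1 * (p $ 2 + k * p $ 1) + c0" for f c0 c1
  proof -
    let ?F = "\<lambda>p. (a - 1) * ln (p $ 1) + c1 * (p $ 2 + k * p $ 1) + c0"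
    let ?P = "\<lambda>j p. if j = 1 then (a - 1) / p $ 1 + c1 * k else c1"
    have F: "(?F has_derivative (\<lambda>v. (a - 1) * v $ 1 / p $ 1 + c1 * (v $ 2 + k * v $ 1))) (at p)"
      if "p \<in> half_plane" for p :: plane
      using that by (auto intro!: derivative_eq_intros simp: half_plane_iff field_simps)
    have D: "deriv_along (frame j) f p = ?P j p" if p: "p \<in> half_plane" for j p
    proof -
      have "deriv_along (frame j) f p = deriv_along (frame j) ?F p"
        by (rule deriv_along_frame_cong[OF open_half_plane p]) (use F[OF p] f in \<open>auto simp: differentiable_def\<close>)
      also have "\<dots> = ?P j p"
        unfolding deriv_along_frame_eqI[OF F[OF p]] using exhaust_2[of j] by (auto simp: axis_def)
      finally show ?thesis .
    qed
    have "potential_system C (ricci_sym_coeff C) f"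
    proof (rule potential_systemI[where P = ?P and Q = "\<lambda>j p v. if j = 1 then - (a - 1) * v $ 1 / (p $ 1)\<^sup>2 else 0"])
      show "smooth_on half_plane f"
      proof (rule smooth_on_cong[OF open_half_plane])
        show "smooth_on half_plane (\<lambda>p. ((a - 1) * ln (p $ 1) + c1 * p $ 2) + (((c1 * k) * p $ 1 + 0 * p $ 2) + c0))"
          by (intro smooth_on_add open_half_plane smooth_on_const
              smooth_on_fst_plus[where I = "{0<..}" and g = "\<lambda>x. (a - 1) * ln x"] smooth_real_ln
              smooth_on_fst_plus[where I = UNIV and g = "\<lambda>x. (c1 * k) * x"] smooth_real_linear)
            (auto simp: half_plane_iff)
      qed (simp add: f algebra_simps)
      show "(?P j has_derivative (\<lambda>v. if j = 1 then - (a - 1) * v $ 1 / (p $ 1)\<^sup>2 else 0)) (at p)"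
        if "p \<in> half_plane" for j p
      proof (cases "j = 1")
        case True
        have "((\<lambda>p::plane. (a - 1) / p $ 1 + c1 * k) has_derivative (\<lambda>v. - (a - 1) * v $ 1 / (p $ 1)\<^sup>2)) (at p)"
          using that by (auto intro!: derivative_eq_intros simp: half_plane_iff power2_eq_square field_simps)
        with True show ?thesis by simp
      qed simp
      fix p :: plane and i j :: 2 assume "p \<in> half_plane"
      then have x: "p $ 1 > 0" by (simp add: half_plane_iff)
      have "k * c1 * e = e * (c1 * k)" by simp
      then show "(if j = 1 then - (a - 1) * axis i 1 $ 1 / (p $ 1)\<^sup>2 else 0) =
          (\<Sum>m\<in>UNIV. C i j m * ?P m p) / p $ 1 - ricci_sym_coeff C i j / (p $ 1)\<^sup>2"
        using exhaust_2[of i] exhaust_2[of j] x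
        by (auto simp: sum_2 C sym[of 2 1] r axis_def field_simps power2_eq_square)
    qed (rule D)
    with D show ?thesis by simp
  qed
  fix f
  show "f \<in> soliton_potentials half_plane (type_B_conn C)"
    if "f \<in> {(\<lambda>p\<in>half_plane. (a - 1) * ln (p $ 1) + c1 * (p $ 2 + k * p $ 1) + c0) | c0 c1. True}"
    using that sys by (auto simp: soliton_potentials_type_B)
  assume "f \<in> soliton_potentials half_plane (type_B_conn C)"
  then have f: "potential_system C (ricci_sym_coeff C) f" and ext: "f \<in> extensional half_plane"
    by (auto simp: soliton_potentials_type_B)
  note smd = smooth_on_differentiable[OF open_half_plane]
  note smD = smooth_on_deriv_along[OF open_half_plane]
  have sf: "smooth_on half_plane f" using f by (simp add: potential_system_def)
  have rsym: "ricci_sym_coeff C i j = ricci_sym_coeff C j i" for i j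
    using exhaust_2[of i] exhaust_2[of j] by (auto simp: r)
  \<comment> \<open>Row 2 of K is e (1 - a) (1, -k), and the factor is nonzero by \<open>ne\<close>:
    integrability alone fixes the derivative of \<open>f\<close> along the level lines of x^2 + k
    x^1.\<close>
  have D1: "deriv_along (frame 1) f p = (a - 1) / p $ 1 + k * deriv_along (frame 2) f p" if p: "p \<in> half_plane" for p
  proof -
    have x: "p $ 1 > 0" using p by (simp add: half_plane_iff)
    have "e * (1 - a) * (p $ 1 * deriv_along (frame 1) f p - k * (p $ 1 * deriv_along (frame 2) f p))
        = e * (1 - a) * (a - 1)"
      using integrability(1)[OF f p sym rsym, of 2]
      by (simp add: type_B_curv_def sum_2 C sym[of 2 1] r algebra_simps)
    then have "p $ 1 * deriv_along (frame 1) f p - k * (p $ 1 * deriv_along (frame 2) f p) = a - 1"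
      using ne unfolding mult_cancel_left by simp
    with x show ?thesis by (simp add: field_simps)
  qed
  \<comment> \<open>The equations for the index pairs containing 2 involve only the combination
    fixed by \<open>D1\<close>, and its contribution cancels the Ricci term.\<close>
  have "deriv_along (frame i) (deriv_along (frame 2) f) p = 0" if p: "p \<in> half_plane" for i p
  proof -
    have x: "p $ 1 > 0" using p by (simp add: half_plane_iff)
    have "deriv_along (frame i) (deriv_along (frame 2) f) p =
        (\<Sum>k\<in>UNIV. C i 2 k * deriv_along (frame k) f p) / p $ 1 - ricci_sym_coeff C i 2 / (p $ 1)\<^sup>2"
      using f p by (simp add: potential_system_def)
    then show ?thesis
      using exhaust_2[of i] x by (auto simp: sum_2 C r D1[OF p] field_simps power2_eq_square)
  qed
  then obtain c1 where c1: "\<And>p. p \<in> half_plane \<Longrightarrow> deriv_along (frame 2) f p = c1"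
    using constant_on_half_plane[OF smD[OF sf]] by metis
  let ?g = "\<lambda>p::plane. (a - 1) * ln (p $ 1) + c1 * (p $ 2 + k * p $ 1) + 0"
  have g: "potential_system C (ricci_sym_coeff C) ?g" "\<And>p. p \<in> half_plane \<Longrightarrow> deriv_along (frame 2) ?g p = c1"
    using sys[of ?g c1 0] by auto
  have sg: "smooth_on half_plane ?g" using g(1) by (simp add: potential_system_def)
  have h: "smooth_on half_plane (\<lambda>p. f p - ?g p)"
    using potential_system_diff[OF f g(1)] by (simp add: potential_system_def)
  have D1': "deriv_along (frame 1) ?g p = (a - 1) / p $ 1 + k * c1" if "p \<in> half_plane" for p
  proof -
    have "(?g has_derivative (\<lambda>v. (a - 1) * v $ 1 / p $ 1 + c1 * (v $ 2 + k * v $ 1))) (at p)"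
      using that by (auto intro!: derivative_eq_intros simp: half_plane_iff field_simps)
    from deriv_along_frame_eqI[OF this] show ?thesis by (simp add: axis_def)
  qed
  have Z: "deriv_along (frame i) (\<lambda>p. f p - ?g p) p = 0" if p: "p \<in> half_plane" for i p
  proof -
    have "deriv_along (frame i) f p = deriv_along (frame i) ?g p"
    proof (cases "i = 1")
      case True
      show ?thesis unfolding True D1[OF p] D1'[OF p] c1[OF p] ..
    next
      case False
      then have "i = 2" using exhaust_2 by blast
      show ?thesis unfolding \<open>i = 2\<close> g(2)[OF p] c1[OF p] ..
    qed
    then show ?thesis unfolding deriv_along_diff[OF smd[OF sf p] smd[OF sg p]] by (rule right_minus_eq[THEN iffD2])
  qed
  obtain c0 where "\<And>p. p \<in> half_plane \<Longrightarrow> f p - ?g p = c0"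
    using constant_on_half_plane[OF h Z] by blast
  then have "f = (\<lambda>p\<in>half_plane. (a - 1) * ln (p $ 1) + c1 * (p $ 2 + k * p $ 1) + c0)"
    using ext by (intro extensionalityI[of _ half_plane]) (auto simp: algebra_simps)
  then show "f \<in> {(\<lambda>p\<in>half_plane. (a - 1) * ln (p $ 1) + c1 * (p $ 2 + k * p $ 1) + c0) | c0 c1. True}"
    by blast
qed

lemma P_surface_sym: "P_surface s a c i j k = P_surface s a c j i k"
  by (auto simp: P_surface_def)

text \<open>The \<open>a\<close> of the general family is \<open>C 1 1 1\<close>, here -1, with k =
  0; both relations become 0 = 0 for either sign.\<close>

lemma soliton_potentials_P_surface_minus_2:
  assumes "s \<in> {1, -1}"
  shows "soliton_potentials half_plane (type_B_conn (P_surface s (-2) 0)) =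
    {(\<lambda>p\<in>half_plane. -2 * ln (p $ 1) + c1 * p $ 2 + c0) | c0 c1. True}"
proof -
  have "soliton_potentials half_plane (type_B_conn (P_surface s (-2) 0)) =
    {(\<lambda>p\<in>half_plane. (-1 - 1) * ln (p $ 1) + c1 * (p $ 2 + 0 * p $ 1) + c0) | c0 c1. True}"
    by (rule soliton_potentials_log_linear[OF P_surface_sym, where e = s])
      (use assms in \<open>auto simp: P_surface_def\<close>)
  then show ?thesis by simp
qed

text \<open>Here the general family has a = 1/2, k = -2c and e = -1. The second relation reads -2
  c^2 = -3/4; the same value of c^2 gives \<open>C 1 1 1\<close> = 1/2 and \<open>C 1 2 2\<close> =
  0.\<close>

lemma soliton_potentials_P_surface_minus_half:
  assumes "c\<^sup>2 = 3 / 8"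
  shows "soliton_potentials half_plane (type_B_conn (P_surface (-1) (-1/2) c)) =
    {(\<lambda>p\<in>half_plane. -(1/2) * ln (p $ 1) + c1 * (p $ 2 - 2 * c * p $ 1) + c0) | c0 c1. True}"
proof -
  have "soliton_potentials half_plane (type_B_conn (P_surface (-1) (-1/2) c)) =
    {(\<lambda>p\<in>half_plane. (1/2 - 1) * ln (p $ 1) + c1 * (p $ 2 + (- 2 * c) * p $ 1) + c0) | c0 c1. True}"
    by (rule soliton_potentials_log_linear[OF P_surface_sym, where e = "-1"])
      (use assms in \<open>auto simp: P_surface_def power2_eq_square\<close>)
  then show ?thesis by simp
qed

subsection \<open>Classification\<close>

lemma parallel_if_common_normal:
  fixes k1 k2 u1 u2 v1 v2 :: real
  assumes "k1 \<noteq> 0 \<or> k2 \<noteq> 0" "k1 * u1 + k2 * u2 = 0" "k1 * v1 + k2 * v2 = 0"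
  shows "u1 * v2 = u2 * v1"
proof -
  have "k1 * (u1 * v2 - u2 * v1) = (k1 * u1 + k2 * u2) * v2 - (k1 * v1 + k2 * v2) * u2"
    "k2 * (u1 * v2 - u2 * v1) = (k1 * v1 + k2 * v2) * u1 - (k1 * u1 + k2 * u2) * v1"
    by (simp_all add: algebra_simps)
  then show ?thesis using assms by auto
qed

text \<open>Here x = C_1 u and y = C_2 u, and torsion-freeness makes x2 also the first component of
  y. By \<open>par\<close> both are multiples of u, so the commutator in K kills u and K u = 0
  reduces to C_2 u = 0.\<close>

lemma common_eigenvector:
  fixes a b c d e g u1 u2 :: real
  defines "x1 \<equiv> a * u1 + b * u2" and "x2 \<equiv> c * u1 + d * u2" and "y2 \<equiv> e * u1 + g * u2"
  assumes u: "u1 \<noteq> 0 \<or> u2 \<noteq> 0"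
    and par: "u1 * x2 = u2 * x1" "u1 * y2 = u2 * x2"
    and Ku: "a * x2 + b * y2 - (c * x1 + d * x2) + x2 = 0" "c * x2 + d * y2 - (e * x1 + g * x2) + y2 = 0"
  shows "x2 = 0" "y2 = 0" "u2 * x1 = 0"
proof -
  obtain \<alpha> where x: "x1 = \<alpha> * u1" "x2 = \<alpha> * u2"
  proof (cases "u1 = 0")
    case True
    with u par that[of "x2 / u2"] show thesis by (simp add: x1_def)
  next
    case False
    with par that[of "x1 / u1"] show thesis by (simp add: field_simps)
  qed
  obtain \<beta> where y: "x2 = \<beta> * u1" "y2 = \<beta> * u2"
  proof (cases "u1 = 0")
    case True
    with u par that[of "y2 / u2"] show thesis by simp
  next
    case False
    with par that[of "x2 / u1"] show thesis by (simp add: field_simps)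
  qed
  have "a * (\<beta> * u1) + b * (\<beta> * u2) = \<beta> * x1" "c * (\<beta> * u1) + d * (\<beta> * u2) = \<beta> * x2"
    "c * (\<alpha> * u1) + d * (\<alpha> * u2) = \<alpha> * x2" "e * (\<alpha> * u1) + g * (\<alpha> * u2) = \<alpha> * y2"
    by (simp_all add: x1_def x2_def y2_def algebra_simps)
  note eig = this[folded x y]
  have "\<beta> * x1 = \<alpha> * x2" unfolding x(1) y(1) by simp
  moreover have "\<beta> * x2 = \<alpha> * y2" unfolding x(2) y(2) by simp
  ultimately show "x2 = 0" "y2 = 0" using Ku unfolding eig by linarith+
  with par show "u2 * x1 = 0" by simp
qed

text \<open>
  The relations of lemma \<open>integrability\<close> when \<open>x\<^sup>2 + k x\<^sup>1\<close> lies in the kernel of the Hessian; then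
  \<open>\<kappa>\<close> is the first column of the curvature matrix, and \<open>\<gamma>\<close> is \<open>C\<^sub>1\<^sub>2\<^sup>1\<close> after the shear that turns this
  function into \<open>x\<^sup>2\<close>.
\<close>

lemma integrability_linear_kernel:
  fixes a c e k w \<kappa>1 \<kappa>2 :: real
  defines "\<gamma> \<equiv> c - k * e"
    and "r11 \<equiv> - k * \<kappa>1" and "r12 \<equiv> (- k * \<kappa>2 - \<kappa>1) / 2" and "r22 \<equiv> - \<kappa>2"
  defines "S1 \<equiv> a * r12 - k * a * r22 - (c * r11 - k * c * r12) + 2 * r12"
    and "S2 \<equiv> c * r12 - k * c * r22 - (e * r11 - k * e * r12) + 2 * r22"
  assumes \<kappa>1_eq: "\<kappa>1 = - a * k * e + k * c\<^sup>2 + c" and \<kappa>2_eq: "\<kappa>2 = c\<^sup>2 - e * a + e"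
    and nz: "\<kappa>1 \<noteq> 0 \<or> \<kappa>2 \<noteq> 0"
    and E0: "\<kappa>1 * w = S1" "\<kappa>2 * w = S2"
    and E1: "\<kappa>1 * ((a * w - r11) - k * (c * w - r12)) = - S1"
      "\<kappa>2 * ((a * w - r11) - k * (c * w - r12)) = - S2"
    and E2: "\<kappa>1 * ((c * w - r12) - k * (e * w - r22)) = 0"
      "\<kappa>2 * ((c * w - r12) - k * (e * w - r22)) = 0"
  shows "(\<gamma> = 0 \<and> e \<noteq> 0 \<and> a = k * c - 1) \<or> (\<gamma> \<noteq> 0 \<and> a = k * c + k * \<gamma> - 1 \<and> 3 * e = - 2 * \<gamma>\<^sup>2)"
proof -
  have \<kappa>1: "\<kappa>1 = k * \<kappa>2 + \<gamma>"
    by (simp add: \<kappa>1_eq \<kappa>2_eq \<gamma>_def algebra_simps power2_eq_square)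
  have "(c * w - r12) - k * (e * w - r22) = 0"
    using E2 nz unfolding mult_eq_0_iff by blast
  then have "\<gamma> * w = r12 - k * r22" by (simp add: \<gamma>_def algebra_simps)
  also have "\<dots> = - \<gamma> / 2" by (simp add: r12_def r22_def \<kappa>1 field_simps)
  finally have g: "\<gamma> * w = - \<gamma> / 2" .
  \<comment> \<open>Adding \<open>E0\<close> and \<open>E1\<close> cancels the inhomogeneous terms,
    after which the nonzero column \<kappa> can be divided out.\<close>
  have "\<kappa>1 * ((a * w - r11) - k * (c * w - r12) + w) = 0" "\<kappa>2 * ((a * w - r11) - k * (c * w - r12) + w) = 0"
    using E0 E1 unfolding distrib_left by simp_all
  with nz have "(a * w - r11) - k * (c * w - r12) + w = 0"
    unfolding mult_eq_0_iff by blast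
  then have "(a - k * c + 1) * w = r11 - k * r12" by (simp add: algebra_simps)
  also have "\<dots> = - k * \<gamma> / 2" by (simp add: r11_def r12_def \<kappa>1 field_simps)
  finally have h: "(a - k * c + 1) * w = - k * \<gamma> / 2" .
  have S2: "\<kappa>2 * w = - \<gamma>\<^sup>2 / 2 - 2 * \<kappa>2"
  proof -
    have "\<kappa>2 * w = \<gamma> * (r12 - k * r22) - e * (r11 - 2 * k * r12 + k\<^sup>2 * r22) + 2 * r22"
      using E0(2) unfolding S2_def \<gamma>_def by (simp add: algebra_simps power2_eq_square)
    also have "\<dots> = - \<gamma>\<^sup>2 / 2 - 2 * \<kappa>2"
      by (simp add: r11_def r12_def r22_def \<kappa>1 field_simps power2_eq_square)
    finally show ?thesis .
  qed
  show ?thesis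
  proof (cases "\<gamma> = 0")
    case True
    with \<kappa>1 nz have k2: "\<kappa>2 \<noteq> 0" by auto
    with S2 True have "\<kappa>2 * (w + 2) = 0" by (simp add: algebra_simps)
    \<comment> \<open>As \<open>w\<close> is x^1 times the derivative of \<open>f\<close> along the
      level lines of x^2 + k x^1, it is the coefficient of log x^1 in the potentials: -2 here, -1/2
      in the other case.\<close>
    with k2 have "w = - 2" by simp
    with h True have "a = k * c - 1" by simp
    moreover have "e \<noteq> 0" using k2 True by (auto simp: \<kappa>2_eq \<gamma>_def)
    ultimately show ?thesis using True by simp
  next
    case False
    have "\<gamma> * (2 * w + 1) = 0" using g by (simp add: algebra_simps)
    with False have w: "w = - 1 / 2" by simp
    with h have a: "a = k * c + k * \<gamma> - 1" by simp
    have "\<kappa>2 = \<gamma>\<^sup>2 + 2 * e"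
      unfolding \<kappa>2_eq a by (simp add: \<gamma>_def algebra_simps power2_eq_square)
    with S2 w have "3 * e = - 2 * \<gamma>\<^sup>2" by (simp add: field_simps)
    with False a show ?thesis by simp
  qed
qed

text \<open>The shear with b = -k turns x^2 + k x^1 into a multiple of x^2. The remaining scale
  multiplies \<open>C 2 2 1\<close> by its square, so only the sign of \<open>C 2 2 1\<close>
  survives.\<close>

lemma linearly_equivalent_P_surface_minus_2:
  fixes C :: christoffel
  assumes sym: "\<And>i j k. C i j k = C j i k"
    and C: "C 1 1 2 = - k * C 1 1 1" "C 1 2 2 = - k * C 1 2 1" "C 2 2 2 = - k * C 2 2 1"
    and "C 1 2 1 = k * C 2 2 1" "C 2 2 1 \<noteq> 0" "C 1 1 1 = k * C 1 2 1 - 1"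
  obtains s where "s \<in> {1, -1}" "linearly_equivalent C (P_surface s (-2) 0)"
proof -
  define e where "e = C 2 2 1"
  define c where "c = 1 / sqrt \<bar>e\<bar>"
  have e: "e \<noteq> 0" using assms by (simp add: e_def)
  have c: "c \<noteq> 0" "c\<^sup>2 * e = sgn e"
    using e by (auto simp: c_def power_divide sgn_if)
  have "linearly_equivalent C (P_surface (sgn e) (-2) 0)"
    by (rule linearly_equivalentI[OF c(1) sym P_surface_sym, where b = "- k"])
      (use c(2) assms in \<open>auto simp: P_surface_def e_def[symmetric] algebra_simps power2_eq_square\<close>)
  with e that[of "sgn e"] show thesis by (simp add: sgn_if split: if_splits)
qed

text \<open>The hypotheses force \<open>C 2 2 1\<close> < 0, so only the lower sign occurs. Making
  \<open>C 1 2 1\<close> vanish fixes the shear \<open>b\<close>, and making \<open>C 2 2 1\<close>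
  equal to -1 fixes the scale \<open>t\<close> up to sign.\<close>

lemma linearly_equivalent_P_surface_minus_half:
  fixes C :: christoffel and k :: real
  defines "\<gamma> \<equiv> C 1 2 1 - k * C 2 2 1"
  assumes sym: "\<And>i j k. C i j k = C j i k"
    and C: "C 1 1 2 = - k * C 1 1 1" "C 1 2 2 = - k * C 1 2 1" "C 2 2 2 = - k * C 2 2 1"
    and "\<gamma> \<noteq> 0" "3 * C 2 2 1 = - 2 * \<gamma>\<^sup>2" "C 1 1 1 = k * C 1 2 1 + k * \<gamma> - 1"
  obtains c where "c \<ge> 0" "c\<^sup>2 = 3 / 8" "linearly_equivalent C (P_surface (-1) (-1/2) c)"
proof -
  define e where "e = C 2 2 1"
  define c where "c = sqrt (3 / 8)"
  have c: "c > 0" "c\<^sup>2 = 3 / 8" by (simp_all add: c_def)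
  have e: "3 * e = - 2 * \<gamma>\<^sup>2" "e \<noteq> 0" using assms by (auto simp: e_def)
  \<comment> \<open>The condition t^2 e = -1 amounts to (t \<gamma>)^2 = 3/2 = 4 c^2; the sign is
    the one for which \<open>C 2 2 2\<close> becomes -2c with c > 0.\<close>
  define t where "t = - 2 * c / \<gamma>"
  have t: "t \<noteq> 0" "t * \<gamma> = - 2 * c" using c \<open>\<gamma> \<noteq> 0\<close> by (simp_all add: t_def)
  have te: "t\<^sup>2 * e = - 1"
  proof -
    have "3 * (t\<^sup>2 * e) = t\<^sup>2 * (3 * e)" by simp
    also have "\<dots> = - 2 * (t * \<gamma>)\<^sup>2" unfolding e(1) by (simp add: power_mult_distrib)
    finally have "3 * (t\<^sup>2 * e) = - 2 * (t * \<gamma>)\<^sup>2" .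
    with t c show ?thesis by (simp add: power_mult_distrib)
  qed
  define b where "b = - C 1 2 1 / e"
  have b: "C 1 2 1 = - b * e" using e by (simp add: b_def)
  have \<gamma>: "\<gamma> = - (b + k) * e" by (simp add: \<gamma>_def b e_def[symmetric] algebra_simps)
  have bk: "(b + k) * t * e = 2 * c" using t \<gamma> by (simp add: algebra_simps)
  have bk2: "(b + k)\<^sup>2 * e = - 3 / 2"
  proof -
    have "e * (3 + 2 * ((b + k)\<^sup>2 * e)) = 0"
      using e(1) unfolding \<gamma> by (simp add: power2_eq_square algebra_simps)
    with e(2) show ?thesis by simp
  qed
  have a: "C 1 1 1 = 1 / 2 + b\<^sup>2 * e"
    using assms(8) bk2 unfolding b \<gamma> by (simp add: algebra_simps power2_eq_square)
  \<comment> \<open>Geometrically, the shear turns x^2 + k x^1 into a multiple of x^2 - 2c x^1, the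
    linear function in the potentials of the model.\<close>
  have ct: "c * t = - (b + k) / 2"
  proof -
    have "(c * t) * (t * e) = (- (b + k) / 2) * (t * e)"
      using te bk by (simp add: algebra_simps power2_eq_square)
    then show ?thesis using t e by simp
  qed
  have P: "P_surface (- 1) (- 1 / 2) c 1 1 1 = 1 / 2" "P_surface (- 1) (- 1 / 2) c 1 1 2 = c"
    "P_surface (- 1) (- 1 / 2) c 1 2 1 = 0" "P_surface (- 1) (- 1 / 2) c 1 2 2 = 0"
    "P_surface (- 1) (- 1 / 2) c 2 2 1 = - 1" "P_surface (- 1) (- 1 / 2) c 2 2 2 = - 2 * c"
    by (simp_all add: P_surface_def c(2) power_divide)
  have equiv: "linearly_equivalent C (P_surface (-1) (-1/2) c)"
  proof (rule linearly_equivalentI[OF t(1) sym P_surface_sym, where b = b])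
    show "P_surface (- 1) (- 1 / 2) c 1 1 1 = C 1 1 1 + 2 * b * C 1 2 1 + b\<^sup>2 * C 2 2 1"
      unfolding P a b e_def[symmetric] by (simp add: algebra_simps power2_eq_square)
    show "b * P_surface (- 1) (- 1 / 2) c 1 1 1 + t * P_surface (- 1) (- 1 / 2) c 1 1 2
        = C 1 1 2 + 2 * b * C 1 2 2 + b\<^sup>2 * C 2 2 2"
      unfolding P C a b e_def[symmetric] using ct by (simp add: algebra_simps power2_eq_square)
    show "P_surface (- 1) (- 1 / 2) c 1 2 1 = t * (C 1 2 1 + b * C 2 2 1)"
      unfolding P b e_def[symmetric] by simp
    show "b * P_surface (- 1) (- 1 / 2) c 1 2 1 + t * P_surface (- 1) (- 1 / 2) c 1 2 2
        = t * (C 1 2 2 + b * C 2 2 2)"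
      unfolding P C b e_def[symmetric] by simp
    show "P_surface (- 1) (- 1 / 2) c 2 2 1 = t\<^sup>2 * C 2 2 1"
      unfolding P e_def[symmetric] te ..
    show "b * P_surface (- 1) (- 1 / 2) c 2 2 1 + t * P_surface (- 1) (- 1 / 2) c 2 2 2 = t\<^sup>2 * C 2 2 2"
    proof -
      have "t\<^sup>2 * (- k * e) = - k * (t\<^sup>2 * e)" by simp
      also have "\<dots> = k" using te by simp
      finally have "t\<^sup>2 * (- k * e) = k" .
      then show ?thesis unfolding P C e_def[symmetric] using ct by (simp add: algebra_simps)
    qed
  qed
  show thesis by (rule that[OF less_imp_le[OF c(1)] c(2) equiv])
qed

theorem theorem4p10:
  fixes C :: christoffel
  assumes torsion_free: "\<And>i j k. C i j k = C j i k"
    and non_flat: "\<not> flat_on half_plane (type_B_conn C)"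
    and not_empty: "soliton_potentials half_plane (type_B_conn C) \<noteq> {}"
    and not_line: "\<not> is_affine_line half_plane (soliton_potentials half_plane (type_B_conn C))"
  shows "\<exists>C'. linearly_equivalent C C' \<and>
    ((type_A half_plane (type_B_conn C') \<and> C' 1 2 1 = 0 \<and> C' 2 2 1 = 0 \<and> C' 2 2 2 = 0)
     \<or> (\<exists>s\<in>{1, -1}. C' = P_surface s (-2) 0 \<and>
          soliton_potentials half_plane (type_B_conn C') =
            {(\<lambda>p\<in>half_plane. -2 * ln (p $ 1) + c1 * p $ 2 + c0) | c0 c1. True})
     \<or> (\<exists>c\<ge>0. c\<^sup>2 = 3/8 \<and> C' = P_surface (-1) (-1/2) c \<and>
          soliton_potentials half_plane (type_B_conn C') =
            {(\<lambda>p\<in>half_plane. -(1/2) * ln (p $ 1) + c1 * (p $ 2 - 2 * c * p $ 1) + c0) | c0 c1. True}))"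
proof -
  obtain f h p k0 where f: "potential_system C (ricci_sym_coeff C) f"
    and h: "potential_system C (\<lambda>i j. 0) h"
    and p: "p \<in> half_plane" and k0: "deriv_along (frame k0) h p \<noteq> 0"
    using nonconstant_difference[OF not_empty not_line] by metis
  have x: "p $ 1 > 0" using p by (simp add: half_plane_iff)
  define u where "u k = p $ 1 * deriv_along (frame k) h p" for k
  define w where "w k = p $ 1 * deriv_along (frame k) f p" for k
  define K where "K = type_B_curv C"
  let ?r = "ricci_sym_coeff C"
  have C21: "C 2 1 k = C 1 2 k" for k by (rule torsion_free)
  have K_nz: "\<exists>j. K j 1 \<noteq> 0 \<or> K j 2 \<noteq> 0"
  proof (rule ccontr)
    assume "\<nexists>j. K j 1 \<noteq> 0 \<or> K j 2 \<noteq> 0"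
    then have "K j l = 0" for j l using exhaust_2[of l] by auto
    then have "flat_on half_plane (type_B_conn C)"
      by (intro flat_on_type_B) (simp add: curv_coeff_eq K_def)
    with non_flat show False ..
  qed
  have rsym: "?r i j = ?r j i" for i j
    using exhaust_2[of i] exhaust_2[of j] by (auto simp: ricci_sym_coeff_eq)
  note If = integrability[OF f p torsion_free rsym, folded w_def type_B_curv_def K_def, unfolded sum_2]
  note Ih = integrability[OF h p torsion_free, folded u_def type_B_curv_def K_def, unfolded sum_2, simplified]
  have u: "u 1 \<noteq> 0 \<or> u 2 \<noteq> 0"
    using k0 x exhaust_2[of k0] by (auto simp: u_def)
  obtain j where j: "K j 1 \<noteq> 0 \<or> K j 2 \<noteq> 0" using K_nz by blast
  \<comment> \<open>A nonzero row of K annihilates u, C_1 u and C_2 u, so in the plane these are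
    proportional.\<close>
  have par: "u 1 * (C 1 2 1 * u 1 + C 1 2 2 * u 2) = u 2 * (C 1 1 1 * u 1 + C 1 1 2 * u 2)"
      "u 1 * (C 2 2 1 * u 1 + C 2 2 2 * u 2) = u 2 * (C 1 2 1 * u 1 + C 1 2 2 * u 2)"
    using parallel_if_common_normal[OF j Ih(1)[of j] Ih(2)[of j]]
      parallel_if_common_normal[OF j Ih(1)[of j] Ih(3)[of j]] by (simp_all add: C21)
  have Ku: "C 1 1 1 * (C 1 2 1 * u 1 + C 1 2 2 * u 2) + C 1 1 2 * (C 2 2 1 * u 1 + C 2 2 2 * u 2)
        - (C 1 2 1 * (C 1 1 1 * u 1 + C 1 1 2 * u 2) + C 1 2 2 * (C 1 2 1 * u 1 + C 1 2 2 * u 2))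
        + (C 1 2 1 * u 1 + C 1 2 2 * u 2) = 0"
      "C 1 2 1 * (C 1 2 1 * u 1 + C 1 2 2 * u 2) + C 1 2 2 * (C 2 2 1 * u 1 + C 2 2 2 * u 2)
        - (C 2 2 1 * (C 1 1 1 * u 1 + C 1 1 2 * u 2) + C 2 2 2 * (C 1 2 1 * u 1 + C 1 2 2 * u 2))
        + (C 2 2 1 * u 1 + C 2 2 2 * u 2) = 0"
    using Ih(1)[of 1] Ih(1)[of 2] by (simp_all add: K_def type_B_curv_def sum_2 C21 algebra_simps)
  note ker = common_eigenvector[OF u par Ku]
  have K: "K 1 1 = C 1 1 2 * C 2 2 1 - C 1 2 2 * C 1 2 1 + C 1 2 1"
    "K 1 2 = C 1 1 1 * C 1 2 2 + C 1 1 2 * C 2 2 2 - C 1 2 1 * C 1 1 2 - (C 1 2 2)\<^sup>2 + C 1 2 2"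
    "K 2 1 = (C 1 2 1)\<^sup>2 + C 1 2 2 * C 2 2 1 - C 2 2 1 * C 1 1 1 - C 2 2 2 * C 1 2 1 + C 2 2 1"
    "K 2 2 = C 1 2 1 * C 1 2 2 - C 2 2 1 * C 1 1 2 + C 2 2 2"
    by (simp_all add: K_def type_B_curv_def sum_2 C21 algebra_simps power2_eq_square)
  have r: "?r 1 1 = K 1 2" "?r 1 2 = (K 2 2 - K 1 1) / 2" "?r 2 1 = (K 2 2 - K 1 1) / 2" "?r 2 2 = - K 2 1"
    by (simp_all add: ricci_sym_coeff_eq K_def)
  show ?thesis
  proof (cases "u 2 = 0")
    case True
    with u ker have C1: "C 1 2 1 = 0" "C 2 2 1 = 0" by auto
    \<comment> \<open>Eliminating \<open>w 2\<close> between the first and third relations leaves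
      the cube of \<open>C 2 2 2\<close>.\<close>
    have "C 2 2 2 = 0"
    proof -
      have "C 2 2 2 * w 2 = - (C 2 2 2 * (C 2 2 2 / 2))"
        using If(1)[of 2] by (simp add: r K C1 C21)
      moreover have "C 2 2 2 * (C 2 2 2 * w 2) = 0"
        using If(3)[of 2] by (simp add: r K C1 C21)
      ultimately show ?thesis by auto
    qed
    with C1 have "type_A half_plane (type_B_conn C)"
      by (intro type_A_type_B_conn torsion_free non_flat)
    moreover have "linearly_equivalent C C"
      by (rule linearly_equivalent_refl) (rule torsion_free)
    ultimately show ?thesis using C1 \<open>C 2 2 2 = 0\<close> by blast
  next
    case False
    \<comment> \<open>At \<open>p\<close> the covector dh is proportional to (k, 1), the
      differential of x^2 + k x^1.\<close>
    define k where "k = u 1 / u 2"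
    have u1: "u 1 = k * u 2" using False by (simp add: k_def)
    have "(k * C 1 1 1 + C 1 1 2) * u 2 = 0" "(k * C 1 2 1 + C 1 2 2) * u 2 = 0" "(k * C 2 2 1 + C 2 2 2) * u 2 = 0"
      using ker(1,2) ker(3)[unfolded mult_eq_0_iff] False unfolding u1 by (simp_all add: algebra_simps)
    then have Ck: "C 1 1 2 = - k * C 1 1 1" "C 1 2 2 = - k * C 1 2 1" "C 2 2 2 = - k * C 2 2 1"
      using False by (simp_all add: add_eq_0_iff)
    have K2: "K i 2 = - k * K i 1" for i
      using exhaust_2[of i] by (auto simp: K Ck algebra_simps power2_eq_square)
    have w: "K i 1 * v1 + K i 2 * v2 = K i 1 * (v1 - k * v2)" for i v1 v2
      unfolding K2 by (simp add: algebra_simps)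
    \<comment> \<open>Every \<open>C i j\<close> and every row of K is now a multiple of (1, -k), so
      df enters only through this number.\<close>
    let ?w = "w 1 - k * w 2"
    have A: "C 1 1 1 * w 1 + C 1 1 2 * w 2 = C 1 1 1 * ?w" "C 1 2 1 * w 1 + C 1 2 2 * w 2 = C 1 2 1 * ?w"
      "C 2 2 1 * w 1 + C 2 2 2 * w 2 = C 2 2 1 * ?w"
      unfolding Ck by (simp_all add: algebra_simps)
    note E = If[unfolded w C21 A]
    have r': "?r 1 1 = - k * K 1 1" "?r 1 2 = (- k * K 2 1 - K 1 1) / 2" "?r 2 1 = (- k * K 2 1 - K 1 1) / 2"
      unfolding r K2 by simp_all
    have "(C 1 2 1 - k * C 2 2 1 = 0 \<and> C 2 2 1 \<noteq> 0 \<and> C 1 1 1 = k * C 1 2 1 - 1) \<or>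
        (C 1 2 1 - k * C 2 2 1 \<noteq> 0 \<and> C 1 1 1 = k * C 1 2 1 + k * (C 1 2 1 - k * C 2 2 1) - 1 \<and>
         3 * C 2 2 1 = - 2 * (C 1 2 1 - k * C 2 2 1)\<^sup>2)"
    proof (rule integrability_linear_kernel[where w = ?w])
      show "K 1 1 = - C 1 1 1 * k * C 2 2 1 + k * (C 1 2 1)\<^sup>2 + C 1 2 1"
        "K 2 1 = (C 1 2 1)\<^sup>2 - C 2 2 1 * C 1 1 1 + C 2 2 1"
        unfolding K Ck by (simp_all add: algebra_simps power2_eq_square)
      show "K 1 1 \<noteq> 0 \<or> K 2 1 \<noteq> 0"
        using j exhaust_2[of j] by (auto simp: K2)
    qed (use E(1)[of 1, unfolded C21 Ck r' r(4)] E(1)[of 2, unfolded C21 Ck r' r(4)]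
          E(2)[of 1, unfolded C21 Ck r' r(4)] E(2)[of 2, unfolded C21 Ck r' r(4)]
          E(3)[of 1, unfolded C21 Ck r' r(4)] E(3)[of 2, unfolded C21 Ck r' r(4)] in \<open>linarith+\<close>)
    then show ?thesis
    proof (elim disjE conjE)
      assume "C 1 2 1 - k * C 2 2 1 = 0" "C 2 2 1 \<noteq> 0" "C 1 1 1 = k * C 1 2 1 - 1"
      then obtain s where "s \<in> {1, -1}" "linearly_equivalent C (P_surface s (-2) 0)"
        using linearly_equivalent_P_surface_minus_2[OF torsion_free Ck] by auto
      then show ?thesis using soliton_potentials_P_surface_minus_2 by blast
    next
      assume "C 1 2 1 - k * C 2 2 1 \<noteq> 0" "3 * C 2 2 1 = - 2 * (C 1 2 1 - k * C 2 2 1)\<^sup>2"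
        "C 1 1 1 = k * C 1 2 1 + k * (C 1 2 1 - k * C 2 2 1) - 1"
      then obtain c where "c \<ge> 0" "c\<^sup>2 = 3 / 8" "linearly_equivalent C (P_surface (-1) (-1/2) c)"
        by (rule linearly_equivalent_P_surface_minus_half[OF torsion_free Ck])
      then show ?thesis using soliton_potentials_P_surface_minus_half by blast
    qed
  qed
qed

end
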